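(* Let $P$ be a (noncommutative) Poisson conformal algebra. Let $\tilde P=P[t^{\pm1}]/(\partial+\partial_t)P[t^{\pm1}]$ and let $a_n$ denote the image of $at^n$ in $\tilde P$ ($a\in P$, $n\in\mathbb{Z}$). (i) Define a bracket $[\cdot,\cdot]$ and an operation $\circ$ on $\tilde P$ by $$[a_m,b_n]=\sum_{j\in\mathbb{N}}\binom{m}{j}(a_{[j]}b)_{m+n-j},\qquad a_m\circ b_n=\sum_{j\in\mathbb{N}}\binom{m}{j}(a_{(j)}b)_{m+n-j}.$$ Then $(\tilde P,\circ,[\cdot,\cdot])$ is a (noncommutative) Poisson algebra. (ii) Set $\mathcal{F}=\{a(z)=\sum_{n\in\mathbb{Z}}a_nz^{-n-1}\mid a\in P\}\subseteq\tilde P[[z^{\pm1}]]$. Then $\mathcal{F}$ is a family of pairwise local $\tilde P$-valued formal distributions, and thus the pair $(\tilde P,\mathcal{F})$ is a formal distribution (noncommutative) Poisson algebra. (iii) The (noncommutative) Poisson conformal algebra $\mathrm{Con}(\tilde P,\mathcal{F})$ is isomorphic to the (noncommutative) Poisson conformal algebra $P$. The statement holds in both versions: with the word "(noncommutative)" included throughout, or omitted throughout.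
   Context: All vector spaces are over $\mathbb{C}$; $\mathbb{N}=\{0,1,2,\dots\}$. Conformal algebras. A conformal algebra is a $\mathbb{C}[\partial]$-module $A$ with a $\mathbb{C}$-bilinear map $A\times A\to A[\lambda]$, $(a,b)\mapsto a_\lambda b$, such that $(\partial a)_\lambda b=-\lambda\, a_\lambda b$ and $a_\lambda(\partial b)=(\partial+\lambda)(a_\lambda b)$. An associative conformal algebra is a conformal algebra $(A,\circ_\lambda)$ with $a\circ_\lambda(b\circ_\mu c)=(a\circ_\lambda b)\circ_{\lambda+\mu}c$; it is commutative if $a\circ_\lambda b=b\circ_{-\lambda-\partial}a$ (with $\partial$ moved to the left, acting on coefficients). A Lie conformal algebra is a conformal algebra $(A,[\cdot_\lambda\cdot])$ with $[a_\lambda b]=-[b_{-\lambda-\partial}a]$ and $[a_\lambda[b_\mu c]]=[[a_\lambda b]_{\lambda+\mu}c]+[b_\mu[a_\lambda c]]$. A Poisson conformal algebra is a $\mathbb{C}[\partial]$-module with a commutative associative conformal structure $\circ_\lambda$ and a Lie conformal structure $[\cdot_\lambda\cdot]$ satisfying $[a_\lambda(b\circ_\mu c)]=[a_\lambda b]\circ_{\lambda+\mu}c+b\circ_\mu[a_\lambda c]$; a noncommutative Poisson conformal algebra is the same without requiring commutativity of $\circ_\lambda$. The $n$-th products $a_{(n)}b$, $a_{[n]}b$ in $P$ are defined by $a\circ_\lambda b=\sum_{n\ge0}\frac{\lambda^n}{n!}a_{(n)}b$, $[a_\lambda b]=\sum_{n\ge0}\frac{\lambda^n}{n!}a_{[n]}b$.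 An isomorphism of (noncommutative) Poisson conformal algebras is a bijective linear map commuting with $\partial$ and preserving both $\lambda$-operations. A (noncommutative) Poisson algebra is a vector space with a commutative associative (respectively, for "noncommutative", an associative) product $\circ$ and a Lie bracket $[\cdot,\cdot]$ with $[a,b\circ c]=[a,b]\circ c+b\circ[a,c]$. Formal distributions. For a vector space $U$, a $U$-valued formal distribution is a series $a(z)=\sum_{n\in\mathbb{Z}}a_nz^{-n-1}$ with $a_n\in U$; the space of these is $U[[z^{\pm1}]]$, the $a_n$ are the Fourier coefficients, and $\mathrm{Res}_z a(z)=a_0$. For distributions with values in a (noncommutative) Poisson algebra $Q$ put $[a(z),b(w)]=\sum_{m,n}[a_m,b_n]z^{-m-1}w^{-n-1}$ and $a(z)\circ b(w)=\sum_{m,n}(a_m\circ b_n)z^{-m-1}w^{-n-1}$. The pair $(a,b)$ is local if for some $N\in\mathbb{N}$: $(z-w)^N[a(z),b(w)]=0$, $(z-w)^Na(z)\circ b(w)=0$ and $(z-w)^Nb(z)\circ a(w)=0$. The $n$-th products of distributions are $(a_{[n]}b)(w)=\mathrm{Res}_z(z-w)^n[a(z),b(w)]$ and $(a_{(n)}b)(w)=\mathrm{Res}_z(z-w)^na(z)\circ b(w)$, $n\in\mathbb{N}$. A formal distribution (noncommutative) Poisson algebra is a pair $(Q,\mathcal{F})$ where $Q$ is a (noncommutative) Poisson algebra and $\mathcal{F}$ is a family of pairwise local $Q$-valued formal distributions whose Fourier coefficients span $Q$. For such a pair, let $\bar{\mathcal{F}}\subseteq Q[[z^{\pm1}]]$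 be the minimal $\mathbb{C}[\partial_z]$-submodule containing $\mathcal{F}$ and closed under all $j$-th products $a_{(j)}b$, $a_{[j]}b$ ($j\in\mathbb{N}$), with $\partial$ acting as $\partial_z$. Then $\bar{\mathcal{F}}$ with $a\circ_\lambda b=\sum_{n}\frac{\lambda^n}{n!}a_{(n)}b$ and $[a_\lambda b]=\sum_n\frac{\lambda^n}{n!}a_{[n]}b$ is a (noncommutative) Poisson conformal algebra, denoted $\mathrm{Con}(Q,\mathcal{F})$. *)

theory Defs
  imports Complex_Main "HOL-Library.Function_Algebras" "HOL-Library.Poly_Mapping"
    "HOL-Computational_Algebra.Polynomial"
begin

section \<open>Complex vector spaces\<close>

class complex_space = ab_group_add +
  fixes scaleC :: "complex \<Rightarrow> 'a \<Rightarrow> 'a" (infixr \<open>*\<^sub>C\<close> 75)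
  assumes scaleC_add_right: "c *\<^sub>C (x + y) = c *\<^sub>C x + c *\<^sub>C y"
    and scaleC_add_left: "(c + d) *\<^sub>C x = c *\<^sub>C x + d *\<^sub>C x"
    and scaleC_scaleC: "c *\<^sub>C (d *\<^sub>C x) = (c * d) *\<^sub>C x"
    and scaleC_one: "1 *\<^sub>C x = x"

global_interpretation cspace: vector_space "scaleC :: complex \<Rightarrow> 'a \<Rightarrow> 'a::complex_space"
  by standard (simp_all add: scaleC_add_right scaleC_add_left scaleC_scaleC scaleC_one)

definition cbilinear :: "('a::complex_space \<Rightarrow> 'b::complex_space \<Rightarrow> 'c::complex_space) \<Rightarrow> bool" where
  "cbilinear f \<longleftrightarrow>
     (\<forall>x. Vector_Spaces.linear scaleC scaleC (f x)) \<and>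
     (\<forall>y. Vector_Spaces.linear scaleC scaleC (\<lambda>x. f x y))"

instantiation "fun" :: (type, complex_space) complex_space
begin

definition scaleC_fun :: "complex \<Rightarrow> ('a \<Rightarrow> 'b) \<Rightarrow> 'a \<Rightarrow> 'b" where
  "scaleC_fun c f = (\<lambda>x. c *\<^sub>C f x)"

instance
  by standard (simp_all add: scaleC_fun_def fun_eq_iff cspace.scale_right_distrib
      cspace.scale_left_distrib)

end

instantiation poly :: (complex_space) complex_space
begin

definition scaleC_poly :: "complex \<Rightarrow> 'a poly \<Rightarrow> 'a poly" where
  "scaleC_poly c = map_poly (scaleC c)"

instance
  by standard (simp_all add: scaleC_poly_def poly_eq_iff coeff_map_poly
      cspace.scale_right_distrib cspace.scale_left_distrib)

end

instantiation poly_mapping :: (type, complex_space) complex_space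
begin

lift_definition scaleC_poly_mapping :: "complex \<Rightarrow> ('a \<Rightarrow>\<^sub>0 'b) \<Rightarrow> 'a \<Rightarrow>\<^sub>0 'b"
  is "\<lambda>c f k. c *\<^sub>C f k"
  by (erule finite_subset[rotated]) auto

instance
  by standard (transfer; simp add: fun_eq_iff cspace.scale_right_distrib
      cspace.scale_left_distrib)+

end


section \<open>Poisson algebras\<close>

locale nc_poisson_algebra =
  fixes mul :: "'q::complex_space \<Rightarrow> 'q \<Rightarrow> 'q"
    and brk :: "'q \<Rightarrow> 'q \<Rightarrow> 'q"
  assumes mul_bilinear: "cbilinear mul"
    and mul_assoc: "mul (mul a b) c = mul a (mul b c)"
    and brk_bilinear: "cbilinear brk"
    and brk_alternating: "brk a a = 0"
    and brk_jacobi: "brk a (brk b c) + brk b (brk c a) + brk c (brk a b) = 0"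
    and leibniz: "brk a (mul b c) = mul (brk a b) c + mul b (brk a c)"

locale poisson_algebra = nc_poisson_algebra +
  assumes mul_comm: "mul a b = mul b a"


section \<open>Conformal algebras\<close>

text \<open>
  \<open>A[\<lambda>]\<close> is rendered as polynomials in one variable with coefficients in \<open>A\<close>, and \<open>A[\<lambda>, \<mu>]\<close> as
  \<open>A[\<lambda>][\<mu>]\<close>, i.e. the outer variable is \<open>\<mu>\<close>. For an operator \<open>T\<close> on a module \<open>M\<close> and a map
  \<open>h : A \<rightarrow> M\<close>, the element \<open>\<Sum>\<^sub>k T\<^sup>k (h p\<^sub>k)\<close> of \<open>M\<close> is what is meant by substituting \<open>T\<close> for the variable
  of \<open>p = \<Sum>\<^sub>k \<nu>\<^sup>k p\<^sub>k\<close> (after applying \<open>h\<close> to the coefficients).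
\<close>

definition poly_subst :: "('a::zero \<Rightarrow> 'm) \<Rightarrow> ('m \<Rightarrow> 'm) \<Rightarrow> 'a poly \<Rightarrow> 'm::comm_monoid_add" where
  "poly_subst h T p = (\<Sum>k\<le>degree p. (T ^^ k) (h (coeff p k)))"

definition const2 :: "'a::zero \<Rightarrow> 'a poly poly" where
  "const2 a = [:[:a:]:]"

definition mult_lam :: "'a::zero poly poly \<Rightarrow> 'a poly poly" where
  "mult_lam = map_poly (pCons 0)"

definition mult_mu :: "'a::zero poly poly \<Rightarrow> 'a poly poly" where
  "mult_mu = pCons 0"

definition mult_lam_mu :: "'a::ab_group_add poly poly \<Rightarrow> 'a poly poly" where
  "mult_lam_mu q = mult_lam q + mult_mu q"

text \<open>
  For \<open>\<lambda>\<close>-products \<open>f\<close>, \<open>g\<close> and operators \<open>S\<close>, \<open>T\<close> of multiplication by elements \<open>\<sigma>\<close>, \<open>\<tau>\<close> of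
  \<open>\<complex>[\<lambda>, \<mu>]\<close>: \<open>nest_right f g a S b T c\<close> is \<open>f(a\<^sub>\<sigma> g(b\<^sub>\<tau> c))\<close> and
  \<open>nest_left f g a S b T c\<close> is \<open>f(g(a\<^sub>\<sigma> b)\<^sub>\<tau> c)\<close>.
\<close>

definition nest_right ::
  "('a::ab_group_add \<Rightarrow> 'a \<Rightarrow> 'a poly) \<Rightarrow> ('a \<Rightarrow> 'a \<Rightarrow> 'a poly) \<Rightarrow>
    'a \<Rightarrow> ('a poly poly \<Rightarrow> 'a poly poly) \<Rightarrow> 'a \<Rightarrow> ('a poly poly \<Rightarrow> 'a poly poly) \<Rightarrow> 'a \<Rightarrow> 'a poly poly"
  where "nest_right f g a S b T c = poly_subst (\<lambda>d. poly_subst const2 S (f a d)) T (g b c)"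

definition nest_left ::
  "('a::ab_group_add \<Rightarrow> 'a \<Rightarrow> 'a poly) \<Rightarrow> ('a \<Rightarrow> 'a \<Rightarrow> 'a poly) \<Rightarrow>
    'a \<Rightarrow> ('a poly poly \<Rightarrow> 'a poly poly) \<Rightarrow> 'a \<Rightarrow> ('a poly poly \<Rightarrow> 'a poly poly) \<Rightarrow> 'a \<Rightarrow> 'a poly poly"
  where "nest_left f g a S b T c = poly_subst (\<lambda>d. poly_subst const2 T (f d c)) S (g a b)"

text \<open>\<open>opposite D f a b\<close> is \<open>f(b\<^sub>-\<^sub>\<lambda>\<^sub>-\<^sub>\<partial> a)\<close> in \<open>A[\<lambda>]\<close>, where \<open>D\<close> is the action of \<open>\<partial>\<close>.\<close>

definition opposite ::
  "('a \<Rightarrow> 'a) \<Rightarrow> ('a::ab_group_add \<Rightarrow> 'a \<Rightarrow> 'a poly) \<Rightarrow> 'a \<Rightarrow> 'a \<Rightarrow> 'a poly" where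
  "opposite D f a b = poly_subst (\<lambda>x. [:x:]) (\<lambda>p. - pCons 0 p - map_poly D p) (f b a)"

locale conformal_algebra =
  fixes A :: "'a::complex_space set"
    and D :: "'a \<Rightarrow> 'a"
    and f :: "'a \<Rightarrow> 'a \<Rightarrow> 'a poly"
  assumes subspace: "cspace.subspace A"
    and D_closed: "a \<in> A \<Longrightarrow> D a \<in> A"
    and D_add: "a \<in> A \<Longrightarrow> b \<in> A \<Longrightarrow> D (a + b) = D a + D b"
    and D_scale: "a \<in> A \<Longrightarrow> D (c *\<^sub>C a) = c *\<^sub>C D a"
    and closed: "a \<in> A \<Longrightarrow> b \<in> A \<Longrightarrow> coeff (f a b) n \<in> A"
    and add_left: "a \<in> A \<Longrightarrow> a' \<in> A \<Longrightarrow> b \<in> A \<Longrightarrow> f (a + a') b = f a b + f a' b"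
    and add_right: "a \<in> A \<Longrightarrow> b \<in> A \<Longrightarrow> b' \<in> A \<Longrightarrow> f a (b + b') = f a b + f a b'"
    and scale_left: "a \<in> A \<Longrightarrow> b \<in> A \<Longrightarrow> f (c *\<^sub>C a) b = c *\<^sub>C f a b"
    and scale_right: "a \<in> A \<Longrightarrow> b \<in> A \<Longrightarrow> f a (c *\<^sub>C b) = c *\<^sub>C f a b"
    and sesqui_left: "a \<in> A \<Longrightarrow> b \<in> A \<Longrightarrow> f (D a) b = - pCons 0 (f a b)"
    and sesqui_right: "a \<in> A \<Longrightarrow> b \<in> A \<Longrightarrow> f a (D b) = map_poly D (f a b) + pCons 0 (f a b)"

locale assoc_conformal_algebra = conformal_algebra +
  assumes assoc: "a \<in> A \<Longrightarrow> b \<in> A \<Longrightarrow> c \<in> A \<Longrightarrow>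
    nest_right f f a mult_lam b mult_mu c = nest_left f f a mult_lam b mult_lam_mu c"

locale lie_conformal_algebra = conformal_algebra +
  assumes skew: "a \<in> A \<Longrightarrow> b \<in> A \<Longrightarrow> f a b = - opposite D f a b"
    and jacobi: "a \<in> A \<Longrightarrow> b \<in> A \<Longrightarrow> c \<in> A \<Longrightarrow>
      nest_right f f a mult_lam b mult_mu c =
        nest_left f f a mult_lam b mult_lam_mu c + nest_right f f b mult_mu a mult_lam c"

locale nc_poisson_conformal_algebra =
  mul: assoc_conformal_algebra A D m + brk: lie_conformal_algebra A D l
  for A :: "'a::complex_space set" and D :: "'a \<Rightarrow> 'a" and m l :: "'a \<Rightarrow> 'a \<Rightarrow> 'a poly" +
  assumes leibniz: "a \<in> A \<Longrightarrow> b \<in> A \<Longrightarrow> c \<in> A \<Longrightarrow>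
    nest_right l m a mult_lam b mult_mu c =
      nest_left m l a mult_lam b mult_lam_mu c + nest_right m l b mult_mu a mult_lam c"

locale poisson_conformal_algebra = nc_poisson_conformal_algebra +
  assumes commutative: "a \<in> A \<Longrightarrow> b \<in> A \<Longrightarrow> m a b = opposite D m a b"

definition poisson_conformal_iso ::
  "'a::complex_space set \<Rightarrow> ('a \<Rightarrow> 'a) \<Rightarrow> ('a \<Rightarrow> 'a \<Rightarrow> 'a poly) \<Rightarrow> ('a \<Rightarrow> 'a \<Rightarrow> 'a poly) \<Rightarrow>
   'b::complex_space set \<Rightarrow> ('b \<Rightarrow> 'b) \<Rightarrow> ('b \<Rightarrow> 'b \<Rightarrow> 'b poly) \<Rightarrow> ('b \<Rightarrow> 'b \<Rightarrow> 'b poly) \<Rightarrow>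
   ('a \<Rightarrow> 'b) \<Rightarrow> bool" where
  "poisson_conformal_iso A D m l A' D' m' l' \<phi> \<longleftrightarrow>
     bij_betw \<phi> A A' \<and>
     (\<forall>a\<in>A. \<forall>b\<in>A. \<phi> (a + b) = \<phi> a + \<phi> b) \<and>
     (\<forall>c. \<forall>a\<in>A. \<phi> (c *\<^sub>C a) = c *\<^sub>C \<phi> a) \<and>
     (\<forall>a\<in>A. \<phi> (D a) = D' (\<phi> a)) \<and>
     (\<forall>a\<in>A. \<forall>b\<in>A. map_poly \<phi> (m a b) = m' (\<phi> a) (\<phi> b)) \<and>
     (\<forall>a\<in>A. \<forall>b\<in>A. map_poly \<phi> (l a b) = l' (\<phi> a) (\<phi> b))"

text \<open>The \<open>n\<close>-th product belonging to a \<open>\<lambda>\<close>-product: \<open>n!\<close> times the coefficient of \<open>\<lambda>\<^sup>n\<close>.\<close>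

definition nth_prod :: "('a::complex_space \<Rightarrow> 'a \<Rightarrow> 'a poly) \<Rightarrow> nat \<Rightarrow> 'a \<Rightarrow> 'a \<Rightarrow> 'a" where
  "nth_prod f n a b = fact n *\<^sub>C coeff (f a b) n"


section \<open>Formal distributions\<close>

text \<open>
  \<open>a(z) = \<Sum>\<^sub>n a\<^sub>n z\<^sup>-\<^sup>n\<^sup>-\<^sup>1\<close> is encoded as \<open>n \<mapsto> a\<^sub>n\<close>, and
  \<open>\<Sum>\<^sub>m\<^sub>,\<^sub>n c\<^sub>m\<^sub>,\<^sub>n z\<^sup>-\<^sup>m\<^sup>-\<^sup>1 w\<^sup>-\<^sup>n\<^sup>-\<^sup>1\<close> as \<open>m n \<mapsto> c\<^sub>m\<^sub>,\<^sub>n\<close>. Vector space operations are pointwise.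
  Multiplication by \<open>z\<close> or \<open>w\<close> thus shifts the respective index up by one, and the \<open>n\<close>-th coefficient of
  \<open>\<partial>\<^sub>z a(z)\<close> is \<open>-n a\<^sub>n\<^sub>-\<^sub>1\<close>.
\<close>

type_synonym 'q fdist = "int \<Rightarrow> 'q"
type_synonym 'q fdist2 = "int \<Rightarrow> int \<Rightarrow> 'q"

definition mult_z_minus_w :: "'q::ab_group_add fdist2 \<Rightarrow> 'q fdist2" where
  "mult_z_minus_w c = (\<lambda>m n. c (m + 1) n - c m (n + 1))"

definition Res_z :: "'q fdist2 \<Rightarrow> 'q fdist" where
  "Res_z c = c 0"

definition deriv_z :: "'q::complex_space fdist \<Rightarrow> 'q fdist" where
  "deriv_z a = (\<lambda>n. - of_int n *\<^sub>C a (n - 1))"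

definition dist_op :: "('q \<Rightarrow> 'q \<Rightarrow> 'q) \<Rightarrow> 'q fdist \<Rightarrow> 'q fdist \<Rightarrow> 'q fdist2" where
  "dist_op f a b = (\<lambda>m n. f (a m) (b n))"

definition dist_prod :: "('q::ab_group_add \<Rightarrow> 'q \<Rightarrow> 'q) \<Rightarrow> nat \<Rightarrow> 'q fdist \<Rightarrow> 'q fdist \<Rightarrow> 'q fdist" where
  "dist_prod f n a b = Res_z ((mult_z_minus_w ^^ n) (dist_op f a b))"

definition local_pair ::
  "('q::ab_group_add \<Rightarrow> 'q \<Rightarrow> 'q) \<Rightarrow> ('q \<Rightarrow> 'q \<Rightarrow> 'q) \<Rightarrow> 'q fdist \<Rightarrow> 'q fdist \<Rightarrow> bool" where
  "local_pair mul brk a b \<longleftrightarrow> (\<exists>N.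
     (mult_z_minus_w ^^ N) (dist_op brk a b) = 0 \<and>
     (mult_z_minus_w ^^ N) (dist_op mul a b) = 0 \<and>
     (mult_z_minus_w ^^ N) (dist_op mul b a) = 0)"

locale nc_formal_dist_poisson_algebra = nc_poisson_algebra mul brk
  for mul brk :: "'q::complex_space \<Rightarrow> 'q \<Rightarrow> 'q" +
  fixes F :: "'q fdist set"
  assumes pairwise_local: "a \<in> F \<Longrightarrow> b \<in> F \<Longrightarrow> local_pair mul brk a b"
    and fourier_span: "cspace.span {a n | a n. a \<in> F} = UNIV"

locale formal_dist_poisson_algebra =
  nc_formal_dist_poisson_algebra mul brk F + poisson_algebra mul brk
  for mul brk :: "'q::complex_space \<Rightarrow> 'q \<Rightarrow> 'q" and F :: "'q fdist set"

definition dist_closure ::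
  "('q::complex_space \<Rightarrow> 'q \<Rightarrow> 'q) \<Rightarrow> ('q \<Rightarrow> 'q \<Rightarrow> 'q) \<Rightarrow> 'q fdist set \<Rightarrow> 'q fdist set" where
  "dist_closure mul brk F = \<Inter> {M. F \<subseteq> M \<and> cspace.subspace M \<and>
     (\<forall>a\<in>M. deriv_z a \<in> M) \<and>
     (\<forall>a\<in>M. \<forall>b\<in>M. \<forall>j. dist_prod mul j a b \<in> M \<and> dist_prod brk j a b \<in> M)}"

text \<open>
  The \<open>\<lambda>\<close>-product \<open>\<Sum>\<^sub>n \<lambda>\<^sup>n/n! dist_prod f n a b\<close>. It is a polynomial, so that \<^const>\<open>Abs_poly\<close> is
  applied properly, as soon as the \<open>n\<close>-th products of \<open>a\<close> and \<open>b\<close> vanish for large \<open>n\<close>; this is the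
  case when \<open>a\<close> and \<open>b\<close> are local.
\<close>

definition dist_lam_prod ::
  "('q::complex_space \<Rightarrow> 'q \<Rightarrow> 'q) \<Rightarrow> 'q fdist \<Rightarrow> 'q fdist \<Rightarrow> 'q fdist poly" where
  "dist_lam_prod f a b = Abs_poly (\<lambda>n. (1 / fact n) *\<^sub>C dist_prod f n a b)"

text \<open>\<open>Con(Q, F)\<close> consists of \<^const>\<open>dist_closure\<close>, \<^const>\<open>deriv_z\<close> and the two \<^const>\<open>dist_lam_prod\<close>.\<close>


section \<open>The quotient of Laurent polynomials\<close>

class cd_module = complex_space +
  fixes der :: "'a \<Rightarrow> 'a" (\<open>\<partial>\<close>)
  assumes der_add: "\<partial> (x + y) = \<partial> x + \<partial> y"
    and der_scaleC: "\<partial> (c *\<^sub>C x) = c *\<^sub>C \<partial> x"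

text \<open>\<open>P[t\<^sup>\<plusminus>\<^sup>1]\<close> is \<^typ>\<open>int \<Rightarrow>\<^sub>0 'p\<close>, where \<^term>\<open>Poly_Mapping.single n a\<close> is \<open>a t\<^sup>n\<close>.\<close>

definition laurent_der :: "(int \<Rightarrow>\<^sub>0 'p::cd_module) \<Rightarrow> int \<Rightarrow>\<^sub>0 'p" where
  "laurent_der = Poly_Mapping.map \<partial>"

lift_definition laurent_dt :: "(int \<Rightarrow>\<^sub>0 'p::complex_space) \<Rightarrow> int \<Rightarrow>\<^sub>0 'p"
  is "\<lambda>p n. of_int (n + 1) *\<^sub>C p (n + 1)"
proof -
  fix p :: "int \<Rightarrow> 'p"
  assume "finite {n. p n \<noteq> 0}"
  then have "finite ((\<lambda>n. n - 1) ` {n. p n \<noteq> 0})" by simp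
  moreover have "{n. of_int (n + 1) *\<^sub>C p (n + 1) \<noteq> 0} \<subseteq> (\<lambda>n. n - 1) ` {n. p n \<noteq> 0}"
    by (auto intro!: image_eqI[where x = "_ + 1"])
  ultimately show "finite {n. of_int (n + 1) *\<^sub>C p (n + 1) \<noteq> 0}"
    by (rule rev_finite_subset)
qed

definition tilde_null :: "(int \<Rightarrow>\<^sub>0 'p::cd_module) set" where
  "tilde_null = range (\<lambda>h. laurent_der h + laurent_dt h)"

lemma der_zero: "\<partial> (0::'p::cd_module) = 0"
  using der_add[of "0::'p" 0] by simp

lemma lookup_laurent_der: "Poly_Mapping.lookup (laurent_der p) n = \<partial> (Poly_Mapping.lookup p n)"
  unfolding laurent_der_def by transfer (simp add: when_def der_zero)

lemma subspace_tilde_null: "cspace.subspace (tilde_null :: (int \<Rightarrow>\<^sub>0 'p::cd_module) set)"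
proof (rule cspace.subspaceI)
  let ?d = "\<lambda>h :: int \<Rightarrow>\<^sub>0 'p. laurent_der h + laurent_dt h"
  have add: "?d (g + h) = ?d g + ?d h" for g h
    by (rule poly_mapping_eqI)
      (simp add: lookup_add lookup_laurent_der laurent_dt.rep_eq der_add
        cspace.scale_right_distrib)
  have scale: "?d (c *\<^sub>C h) = c *\<^sub>C ?d h" for c h
    by (rule poly_mapping_eqI)
      (simp add: lookup_add lookup_laurent_der laurent_dt.rep_eq scaleC_poly_mapping.rep_eq
        der_scaleC cspace.scale_right_distrib mult.commute)
  show "0 \<in> (tilde_null :: (int \<Rightarrow>\<^sub>0 'p) set)"
    using scale[of 0 0] by (auto simp: tilde_null_def intro!: image_eqI[where x = 0])
  show "x + y \<in> tilde_null" if "x \<in> tilde_null" "y \<in> tilde_null" for x y :: "int \<Rightarrow>\<^sub>0 'p"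
    using that unfolding tilde_null_def by (metis (no_types, lifting) add image_iff rangeI)
  show "c *\<^sub>C x \<in> tilde_null" if "x \<in> tilde_null" for c and x :: "int \<Rightarrow>\<^sub>0 'p"
    using that unfolding tilde_null_def by (metis (no_types, lifting) scale image_iff rangeI)
qed

definition tilde_rel :: "(int \<Rightarrow>\<^sub>0 'p::cd_module) \<Rightarrow> (int \<Rightarrow>\<^sub>0 'p) \<Rightarrow> bool" where
  "tilde_rel p q \<longleftrightarrow> p - q \<in> tilde_null"

quotient_type (overloaded) 'p tilde = "int \<Rightarrow>\<^sub>0 'p::cd_module" / tilde_rel
proof (rule equivpI)
  note sub = subspace_tilde_null
  show "reflp (tilde_rel :: (int \<Rightarrow>\<^sub>0 'p) \<Rightarrow> _)"
    by (simp add: reflp_def tilde_rel_def cspace.subspace_0[OF sub])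
  show "symp (tilde_rel :: (int \<Rightarrow>\<^sub>0 'p) \<Rightarrow> _)"
    unfolding symp_def tilde_rel_def using cspace.subspace_neg[OF sub] by (metis minus_diff_eq)
  show "transp (tilde_rel :: (int \<Rightarrow>\<^sub>0 'p) \<Rightarrow> _)"
    unfolding transp_def tilde_rel_def using cspace.subspace_add[OF sub]
    by (metis diff_add_cancel add_diff_eq)
qed

instantiation tilde :: (cd_module) complex_space
begin

lift_definition zero_tilde :: "'a tilde" is 0 .

lift_definition plus_tilde :: "'a tilde \<Rightarrow> 'a tilde \<Rightarrow> 'a tilde" is "(+)"
  unfolding tilde_rel_def
  by (simp only: add_diff_add cspace.subspace_add[OF subspace_tilde_null])

lift_definition uminus_tilde :: "'a tilde \<Rightarrow> 'a tilde" is uminus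
  unfolding tilde_rel_def
  by (metis minus_diff_minus cspace.subspace_neg[OF subspace_tilde_null])

lift_definition minus_tilde :: "'a tilde \<Rightarrow> 'a tilde \<Rightarrow> 'a tilde" is "(-)"
  unfolding tilde_rel_def
proof -
  fix p p' q q' :: "int \<Rightarrow>\<^sub>0 'a"
  assume "p - p' \<in> tilde_null" "q - q' \<in> tilde_null"
  then have "(p - p') - (q - q') \<in> tilde_null"
    by (rule cspace.subspace_diff[OF subspace_tilde_null])
  then show "(p - q) - (p' - q') \<in> tilde_null" by (simp add: algebra_simps)
qed

lift_definition scaleC_tilde :: "complex \<Rightarrow> 'a tilde \<Rightarrow> 'a tilde" is scaleC
  unfolding tilde_rel_def
  by (metis cspace.scale_right_diff_distrib cspace.subspace_scale[OF subspace_tilde_null])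

instance
proof
  have eq: "p = q \<Longrightarrow> tilde_rel p q" for p q :: "int \<Rightarrow>\<^sub>0 'a"
    by (simp add: tilde_rel_def cspace.subspace_0[OF subspace_tilde_null])
  fix x y z :: "'a tilde" and c d :: complex
  show "x + y + z = x + (y + z)" by transfer (rule eq, simp add: add.assoc)
  show "x + y = y + x" by transfer (rule eq, simp add: add.commute)
  show "0 + x = x" by transfer (rule eq, simp)
  show "- x + x = 0" by transfer (rule eq, simp)
  show "x - y = x + - y" by transfer (rule eq, simp)
  show "c *\<^sub>C (x + y) = c *\<^sub>C x + c *\<^sub>C y"
    by transfer (rule eq, rule cspace.scale_right_distrib)
  show "(c + d) *\<^sub>C x = c *\<^sub>C x + d *\<^sub>C x"
    by transfer (rule eq, rule cspace.scale_left_distrib)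
  show "c *\<^sub>C d *\<^sub>C x = (c * d) *\<^sub>C x" by transfer (rule eq, simp)
  show "1 *\<^sub>C x = x" by transfer (rule eq, simp)
qed

end

text \<open>\<open>tilde_elem a n\<close> is \<open>a\<^sub>n\<close>, so that \<open>tilde_elem a\<close> encodes the distribution \<open>a(z)\<close>.\<close>

definition tilde_elem :: "'p::cd_module \<Rightarrow> int \<Rightarrow> 'p tilde" where
  "tilde_elem a n = abs_tilde (Poly_Mapping.single n a)"

definition tilde_dists :: "'p::cd_module tilde fdist set" where
  "tilde_dists = range tilde_elem"

text \<open>
  \<open>B\<close> is the operation on the quotient that a \<open>\<lambda>\<close>-product \<open>f\<close> determines by
  \<open>B(a\<^sub>m, b\<^sub>n) = \<Sum>\<^sub>j (m choose j) (a f\<^sub>j b)\<^sub>m\<^sub>+\<^sub>n\<^sub>-\<^sub>j\<close>; the summands with \<open>j > degree (f a b)\<close> are zero.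
\<close>

definition tilde_operation ::
  "('p::cd_module \<Rightarrow> 'p \<Rightarrow> 'p poly) \<Rightarrow> ('p tilde \<Rightarrow> 'p tilde \<Rightarrow> 'p tilde) \<Rightarrow> bool" where
  "tilde_operation f B \<longleftrightarrow> cbilinear B \<and>
     (\<forall>a b m n. B (tilde_elem a m) (tilde_elem b n) =
        (\<Sum>j\<le>degree (f a b).
          ((of_int m :: complex) gchoose j) *\<^sub>C tilde_elem (nth_prod f j a b) (m + n - int j)))"

end

theory Submission
  imports Defs
begin

text \<open>
  The idea is to read \<open>a\<^sub>m\<close> as \<open>a s\<^sup>m\<close> and a \<open>\<lambda>\<close>-product as a bidifferential operator. In these terms the
  product of \<open>a\<^sub>m\<close> and \<open>b\<^sub>n\<close> is obtained from \<open>a\<^sub>\<lambda>b\<close> by substituting \<open>\<partial>\<^sub>s\<close> for \<open>\<lambda>\<close>, applying the result to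
  \<open>s\<^sup>m t\<^sup>n\<close> and setting \<open>s = t\<close>: indeed \<open>\<partial>\<^sub>s\<^sup>j s\<^sup>m\<close> is a falling factorial times \<open>s\<^sup>m\<^sup>-\<^sup>j\<close>, and the falling factorial
  is \<open>j!\<close> times the binomial coefficient in the definition of the product. This substitution is called
  \<open>lam_eval\<close> below, and \<open>lam_mu_eval\<close> for polynomials in \<open>\<lambda>\<close> and \<open>\<mu>\<close>, which are evaluated at monomials in
  three variables.

  Every algebraic assertion is then the evaluation of an axiom of \<open>P\<close>. In the quotient, \<open>\<partial>\<close> is minus
  the total derivative. Sesquilinearity therefore says that the product is well defined
  (\<open>tilde_operation_exists\<close>); \<open>-\<lambda> - \<partial>\<close> is the derivative in the other variable, so skew-symmetry and
  commutativity carry over (\<open>lam_eval_opposite\<close>); and \<open>\<lambda> + \<mu>\<close> is the derivative after the first two variables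
  have been identified, so the nested \<open>\<lambda>\<close>-products evaluate to the bracketings of three generators
  (\<open>product_eq_nest_right\<close>, \<open>product_eq_nest_left\<close>). As the generators span, associativity, the Jacobi
  identity and the Leibniz rule follow.

  On distributions, multiplication by \<open>z - w\<close> shifts the sequence of \<open>j\<close>-th products by one
  (\<open>mult_z_minus_w_power_tilde\<close>). This yields locality, and it shows that the \<open>k\<close>-th product of \<open>a(z)\<close> and
  \<open>b(z)\<close> is the distribution of the \<open>k\<close>-th product of \<open>a\<close> and \<open>b\<close>. Hence the family of all \<open>a(z)\<close> is its own
  closure, and \<open>a \<mapsto> a(z)\<close> is a surjection onto it that respects all the structure. It is injective
  because \<open>a\<^sub>-\<^sub>1\<close> determines \<open>a\<close> (\<open>tilde_elem_inj\<close>), so it is an isomorphism, and the axioms of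
  \<open>P\<close> are transported along it.
\<close>


section \<open>Linear and bilinear maps\<close>

abbreviation clinear :: "('a::complex_space \<Rightarrow> 'b::complex_space) \<Rightarrow> bool" where
  "clinear \<equiv> Vector_Spaces.linear scaleC scaleC"

lemma clinear_iff:
  "clinear f \<longleftrightarrow> (\<forall>x y. f (x + y) = f x + f y) \<and> (\<forall>c x. f (c *\<^sub>C x) = c *\<^sub>C f x)"
  by (simp add: Vector_Spaces.linear_iff cspace.vector_space_axioms)

lemma cbilinear_iff:
  "cbilinear f \<longleftrightarrow>
     (\<forall>x y z. f x (y + z) = f x y + f x z) \<and> (\<forall>c x y. f x (c *\<^sub>C y) = c *\<^sub>C f x y) \<and>
     (\<forall>x y z. f (x + y) z = f x z + f y z) \<and> (\<forall>c x y. f (c *\<^sub>C x) y = c *\<^sub>C f x y)"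
  unfolding cbilinear_def clinear_iff by blast

lemma additive_if_clinear: "clinear f \<Longrightarrow> additive f"
  by (simp add: clinear_iff additive_def)

lemma cbilinear_additive:
  assumes "cbilinear f"
  shows "additive (f x)" "additive (\<lambda>x. f x y)"
  using assms by (simp_all add: cbilinear_iff additive_def)


section \<open>Falling factorials\<close>

definition falling :: "int \<Rightarrow> nat \<Rightarrow> complex" where
  "falling m j = fact j * (of_int m gchoose j)"

lemma falling_0 [simp]: "falling m 0 = 1"
  by (simp add: falling_def)

lemma falling_Suc: "falling m (Suc j) = of_int m * falling (m - 1) j"
proof -
  have "falling m (Suc j) = fact j * (of_nat (Suc j) * (of_int m gchoose Suc j))"
    by (simp add: falling_def algebra_simps)
  also have "\<dots> = fact j * (of_int m * ((of_int m - 1) gchoose j))"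
    by (simp only: gbinomial_absorption)
  finally show ?thesis by (simp add: falling_def)
qed

lemma falling_Suc_right: "falling m (Suc j) = of_int (m - int j) * falling m j"
proof (induction j arbitrary: m)
  case (Suc j)
  have "falling m (Suc (Suc j)) = of_int m * falling (m - 1) (Suc j)"
    by (rule falling_Suc)
  also have "\<dots> = of_int (m - 1 - int j) * (of_int m * falling (m - 1) j)"
    by (simp add: Suc)
  also have "\<dots> = of_int (m - 1 - int j) * falling m (Suc j)"
    by (simp only: falling_Suc)
  finally show ?case by (simp add: algebra_simps)
qed (simp add: falling_def)


section \<open>Evaluation of polynomials as differential operators\<close>

text \<open>
  This is the common form of \<^const>\<open>poly_subst\<close> and of the evaluations below. Degrees are not additive,
  so sums for different polynomials have to be compared over a common larger range of indices.
\<close>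

definition coeff_sum :: "(nat \<Rightarrow> 'a::ab_group_add \<Rightarrow> 'b::ab_group_add) \<Rightarrow> 'a poly \<Rightarrow> 'b" where
  "coeff_sum g p = (\<Sum>j\<le>degree p. g j (coeff p j))"

lemma coeff_sum_upto:
  assumes "\<And>j. g j 0 = 0" and "degree p \<le> K"
  shows "coeff_sum g p = (\<Sum>j\<le>K. g j (coeff p j))"
  unfolding coeff_sum_def using assms
  by (intro sum.mono_neutral_left) (auto simp: coeff_eq_0)

lemma coeff_sum_add:
  assumes "\<And>j. additive (g j)"
  shows "coeff_sum g (p + q) = coeff_sum g p + coeff_sum g q"
proof -
  note zero = additive.zero[OF assms]
  let ?K = "max (degree p) (degree q)"
  have "coeff_sum g (p + q) = (\<Sum>j\<le>?K. g j (coeff (p + q) j))"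
    by (rule coeff_sum_upto) (use zero degree_add_le_max in auto)
  also have "\<dots> = (\<Sum>j\<le>?K. g j (coeff p j)) + (\<Sum>j\<le>?K. g j (coeff q j))"
    by (simp add: additive.add[OF assms] sum.distrib)
  also have "\<dots> = coeff_sum g p + coeff_sum g q"
    using zero by (simp add: coeff_sum_upto[where K = ?K])
  finally show ?thesis .
qed

lemma coeff_sum_pCons:
  assumes "\<And>j. g j 0 = 0"
  shows "coeff_sum g (pCons x p) = g 0 x + coeff_sum (\<lambda>j. g (Suc j)) p"
proof -
  have "coeff_sum g (pCons x p) = (\<Sum>j\<le>Suc (degree p). g j (coeff (pCons x p) j))"
    by (rule coeff_sum_upto) (simp_all add: assms degree_pCons_le)
  then show ?thesis
    by (simp only: sum.atMost_Suc_shift coeff_sum_def coeff_pCons_0 coeff_pCons_Suc)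
qed

lemma coeff_sum_map_poly:
  assumes "\<And>j. g j 0 = 0" and "h 0 = 0"
  shows "coeff_sum g (map_poly h p) = coeff_sum (\<lambda>j x. g j (h x)) p"
proof -
  have "degree (map_poly h p) \<le> degree p"
    by (rule degree_le) (simp add: coeff_map_poly assms coeff_eq_0)
  with assms have "coeff_sum g (map_poly h p) = (\<Sum>j\<le>degree p. g j (coeff (map_poly h p) j))"
    by (intro coeff_sum_upto)
  then show ?thesis using assms by (simp add: coeff_map_poly coeff_sum_def)
qed

lemma additive_coeff_sum:
  assumes "additive L"
  shows "L (coeff_sum g p) = coeff_sum (\<lambda>j x. L (g j x)) p"
  by (simp add: coeff_sum_def additive.sum[OF assms])

lemma poly_subst_eq_coeff_sum: "poly_subst h T p = coeff_sum (\<lambda>k x. (T ^^ k) (h x)) p"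
  by (simp add: poly_subst_def coeff_sum_def)

text \<open>
  Think of \<open>e x N\<close> as \<open>x t\<^sup>N\<close>. Then \<open>diff_eval e m N p\<close> is what \<open>p\<close> becomes when its variable is replaced
  by \<open>\<partial>\<^sub>s\<close>, the resulting operator is applied to \<open>s\<^sup>m t\<^sup>N\<^sup>-\<^sup>m\<close>, and \<open>s\<close> is then set to \<open>t\<close>. The index \<open>N\<close> is the
  total degree; it is a separate parameter, rather than the exponent of \<open>t\<close>, because every operator
  occurring below lowers it by one, whichever variable it differentiates.
\<close>

definition diff_eval ::
  "('a::ab_group_add \<Rightarrow> int \<Rightarrow> 'q::complex_space) \<Rightarrow> int \<Rightarrow> int \<Rightarrow> 'a poly \<Rightarrow> 'q" where
  "diff_eval e m N = coeff_sum (\<lambda>j x. falling m j *\<^sub>C e x (N - int j))"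

context
  fixes e :: "'a::ab_group_add \<Rightarrow> int \<Rightarrow> 'q::complex_space"
  assumes e: "\<And>N. additive (\<lambda>x. e x N)"
begin

lemma diff_eval_additive: "additive (diff_eval e m N)"
proof (rule additive.intro, unfold diff_eval_def, rule coeff_sum_add)
  show "additive (\<lambda>x. falling m j *\<^sub>C e x (N - int j))" for j
    using e by (simp add: additive_def scaleC_add_right)
qed

lemma diff_eval_pCons:
  "diff_eval e m N (pCons x p) = e x N + of_int m *\<^sub>C diff_eval e (m - 1) (N - 1) p"
  using e[THEN additive.zero]
  by (simp add: diff_eval_def coeff_sum_pCons additive_coeff_sum[of "scaleC _"] falling_Suc
      additive_def scaleC_add_right diff_diff_eq)

lemma diff_eval_const: "diff_eval e m N [:x:] = e x N"
  using diff_eval_pCons[of m N x 0] additive.zero[OF diff_eval_additive] by simp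

lemma diff_eval_pCons_0:
  "diff_eval e m N (pCons 0 p) = of_int m *\<^sub>C diff_eval e (m - 1) (N - 1) p"
  using e[THEN additive.zero] by (simp add: diff_eval_pCons)

lemma diff_eval_map_poly:
  assumes "h 0 = 0"
  shows "diff_eval e m N (map_poly h p) = diff_eval (\<lambda>x. e (h x)) m N p"
  using e[THEN additive.zero] assms by (simp add: diff_eval_def coeff_sum_map_poly)

end

lemma clinear_diff_eval:
  assumes "clinear L"
  shows "L (diff_eval e m N p) = diff_eval (\<lambda>x N. L (e x N)) m N p"
  using assms by (simp add: diff_eval_def additive_coeff_sum[OF additive_if_clinear] clinear_iff)

lemma diff_eval_shift: "diff_eval (\<lambda>x N. e x (N + r)) m N p = diff_eval e m (N + r) p"
  by (simp add: diff_eval_def add_diff_eq algebra_simps)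

text \<open>
  The bridge to the axioms of conformal algebras, in which all expressions are built with
  \<^const>\<open>poly_subst\<close>: to evaluate a substitution it is enough to know the effect of powers of the
  substituted operator.
\<close>

lemma diff_eval_poly_subst:
  assumes "additive L" and "\<And>k x. L ((T ^^ k) (h x)) = falling m k *\<^sub>C e x (N - int k)"
  shows "L (poly_subst h T p) = diff_eval e m N p"
  by (simp add: diff_eval_def poly_subst_eq_coeff_sum additive_coeff_sum[OF assms(1)] assms(2))

text \<open>
  All operators of multiplication by a variable turn into derivatives under evaluation, so they act
  on a monomial with exponent \<open>m\<close> by the factor \<open>m\<close> and a shift. Powers of such operators produce
  falling factorials.
\<close>

lemma iterated_derivation:
  fixes \<Phi> :: "int \<Rightarrow> int \<Rightarrow> 'a \<Rightarrow> 'q::complex_space"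
  assumes "\<And>m N q. \<Phi> m N (T q) = of_int m *\<^sub>C \<Phi> (m - 1) (N - 1) q"
  shows "\<Phi> m N ((T ^^ k) q) = falling m k *\<^sub>C \<Phi> (m - int k) (N - int k) q"
proof (induction k arbitrary: m N)
  case (Suc k)
  then show ?case
    by (simp add: assms falling_Suc diff_diff_eq)
qed simp


section \<open>The quotient of Laurent polynomials\<close>

lemma abs_tilde_add: "abs_tilde (p + q) = abs_tilde p + abs_tilde q"
  by (simp add: plus_tilde.abs_eq)

lemma tilde_elem_add: "tilde_elem (a + b) n = tilde_elem a n + tilde_elem b n"
  by (simp add: tilde_elem_def single_add abs_tilde_add)

lemma tilde_elem_additive: "additive (\<lambda>a. tilde_elem a n)"
  by (simp add: additive_def tilde_elem_add)

lemma single_scaleC: "Poly_Mapping.single n (c *\<^sub>C a) = c *\<^sub>C Poly_Mapping.single n (a::'a::complex_space)"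
  by (rule poly_mapping_eqI)
    (simp add: scaleC_poly_mapping.rep_eq lookup_single when_def)

lemma tilde_elem_scaleC: "tilde_elem (c *\<^sub>C a) n = c *\<^sub>C tilde_elem a n"
  by (simp add: tilde_elem_def single_scaleC scaleC_tilde.abs_eq)

lemma abs_tilde_eq_iff: "abs_tilde p = abs_tilde q \<longleftrightarrow> p - q \<in> tilde_null"
  using Quotient_tilde by (simp add: tilde.abs_eq_iff tilde_rel_def)

lemma laurent_der_single: "laurent_der (Poly_Mapping.single n a) = Poly_Mapping.single n (\<partial> a)"
  by (rule poly_mapping_eqI) (simp add: lookup_laurent_der lookup_single when_def der_zero)

lemma laurent_dt_single:
  "laurent_dt (Poly_Mapping.single n a) = Poly_Mapping.single (n - 1) (of_int n *\<^sub>C a)"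
  by (rule poly_mapping_eqI) (auto simp: laurent_dt.rep_eq lookup_single when_def)

lemma tilde_elem_der: "tilde_elem (\<partial> a) n = - of_int n *\<^sub>C tilde_elem a (n - 1)"
proof -
  have "Poly_Mapping.single n (\<partial> a) + Poly_Mapping.single (n - 1) (of_int n *\<^sub>C a) \<in> tilde_null"
    unfolding tilde_null_def
    by (metis (no_types, lifting) laurent_der_single laurent_dt_single rangeI)
  then have "tilde_elem (\<partial> a) n + tilde_elem (of_int n *\<^sub>C a) (n - 1) = 0"
    by (simp add: tilde_elem_def abs_tilde_eq_iff zero_tilde_def flip: abs_tilde_add)
  then show ?thesis
    by (simp add: tilde_elem_scaleC eq_neg_iff_add_eq_0)
qed

lemma deriv_z_tilde_elem: "deriv_z (tilde_elem a) = tilde_elem (\<partial> a)"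
  by (simp add: deriv_z_def fun_eq_iff tilde_elem_der)

lemma poly_mapping_single_induct:
  assumes "\<And>n a. P (Poly_Mapping.single n a)" and "\<And>p q. P p \<Longrightarrow> P q \<Longrightarrow> P (p + q)"
  shows "P (p :: 'i \<Rightarrow>\<^sub>0 'a::ab_group_add)"
proof (induction p rule: update_induct)
  case const
  then show ?case using assms(1)[of undefined 0] by simp
next
  case (update f a b)
  have "Poly_Mapping.update a b f = f + Poly_Mapping.single a b"
    using update by (intro poly_mapping_eqI)
      (auto simp: lookup_update lookup_add lookup_single when_def in_keys_iff)
  then show ?case using assms update by simp
qed

text \<open>
  There is no case for multiples, as \<open>c a\<^sub>n = (c a)\<^sub>n\<close>.
\<close>

lemma tilde_induct [case_names elem add]:
  assumes "\<And>a n. P (tilde_elem a n)" and "\<And>x y. P x \<Longrightarrow> P y \<Longrightarrow> P (x + y)"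
  shows "P x"
proof (induction x rule: tilde.abs_induct)
  case (1 p)
  show ?case
    by (induction p rule: poly_mapping_single_induct)
      (use assms in \<open>simp_all add: abs_tilde_add flip: tilde_elem_def\<close>)
qed

lemma clinear_tilde_eqI:
  assumes "clinear F" "clinear G" and "\<And>a n. F (tilde_elem a n) = G (tilde_elem a n)"
  shows "F = G"
proof
  show "F x = G x" for x
    by (induction x rule: tilde_induct) (use assms in \<open>simp_all add: clinear_iff\<close>)
qed

text \<open>
  This is why passing to the quotient loses no information on \<open>P\<close>. Already \<open>a\<^sub>-\<^sub>1\<close> determines \<open>a\<close>:
  if \<open>a t\<^sup>-\<^sup>1 = (\<partial> + \<partial>\<^sub>t) h\<close>, then for \<open>n < -1\<close> the coefficients satisfy \<open>\<partial> h\<^sub>n + (n + 1) h\<^sub>n\<^sub>+\<^sub>1 = 0\<close>. Since \<open>h\<^sub>n\<close>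
  vanishes for very negative \<open>n\<close>, this recursion gives \<open>h\<^sub>n = 0\<close> for all \<open>n \<le> -1\<close>. In degree \<open>-1\<close> the
  factor \<open>n + 1\<close> is zero, and what remains is \<open>a = \<partial> h\<^sub>-\<^sub>1 = 0\<close>.
\<close>

lemma tilde_elem_inj: "inj (tilde_elem :: 'p::cd_module \<Rightarrow> _)"
proof -
  have kernel: "a = 0" if "tilde_elem a (- 1) = 0" for a :: 'p
  proof -
    have "Poly_Mapping.single (- 1) a \<in> tilde_null"
      using that by (simp add: tilde_elem_def zero_tilde_def abs_tilde_eq_iff)
    then obtain h where h: "Poly_Mapping.single (- 1) a = laurent_der h + laurent_dt h"
      by (auto simp: tilde_null_def)
    have coeff: "Poly_Mapping.lookup (Poly_Mapping.single (- 1) a) n =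
        \<partial> (Poly_Mapping.lookup h n) + of_int (n + 1) *\<^sub>C Poly_Mapping.lookup h (n + 1)" for n
      by (simp add: h lookup_add lookup_laurent_der laurent_dt.rep_eq)
    (* The recursion starts below all exponents of h. *)
    have "\<exists>K. \<forall>n\<in>Poly_Mapping.keys h. K \<le> n"
      by (metis finite_keys Min_le)
    then obtain K where "\<forall>n\<in>Poly_Mapping.keys h. K \<le> n" ..
    then have small: "Poly_Mapping.lookup h n = 0" if "n < K" for n
      using that by (force simp: in_keys_iff)
    have "K - 1 + int i \<le> - 1 \<Longrightarrow> Poly_Mapping.lookup h (K - 1 + int i) = 0" for i
    proof (induction i)
      case 0
      show ?case by (simp add: small)
    next
      case (Suc i)
      then have "of_int (K + int i) *\<^sub>C Poly_Mapping.lookup h (K + int i) = 0"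
        using coeff[of "K - 1 + int i"] by (simp add: der_zero lookup_single_not_eq)
      moreover have "(of_int (K + int i) :: complex) \<noteq> 0"
        using Suc.prems by (simp only: of_int_eq_0_iff)
      ultimately show ?case by (simp add: cspace.scale_eq_0_iff)
    qed
    from this[of "nat (- K)"] have "Poly_Mapping.lookup h (- 1) = 0"
      by (cases "K \<le> 0") (simp_all add: small)
    with coeff[of "- 1"] show ?thesis by (simp add: der_zero)
  qed
  show ?thesis
  proof (rule injI)
    fix a b :: 'p
    assume "tilde_elem a = tilde_elem b"
    then have "tilde_elem (a - b) (- 1) = 0"
      using additive.diff[OF tilde_elem_additive, of a b "- 1"] by simp
    from kernel[OF this] show "a = b" by simp
  qed
qed

text \<open>
  The universal property of the quotient: since \<open>P[t\<^sup>\<plusminus>\<^sup>1]\<close> is spanned by the \<open>a t\<^sup>n\<close>, the subspace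
  \<^const>\<open>tilde_null\<close> is spanned by the \<open>(\<partial> a) t\<^sup>n + n a t\<^sup>n\<^sup>-\<^sup>1\<close>, and the condition \<open>der\<close> says that \<open>g\<close> kills these.
\<close>

lemma tilde_universal:
  fixes g :: "'p::cd_module \<Rightarrow> int \<Rightarrow> 'q::complex_space"
  assumes add: "\<And>a b n. g (a + b) n = g a n + g b n"
    and scale: "\<And>c a n. g (c *\<^sub>C a) n = c *\<^sub>C g a n"
    and der: "\<And>a n. g (\<partial> a) n = - of_int n *\<^sub>C g a (n - 1)"
  obtains G where "clinear G" "\<And>a n. G (tilde_elem a n) = g a n"
proof -
  define G0 where "G0 p = (\<Sum>n\<in>Poly_Mapping.keys p. g (Poly_Mapping.lookup p n) n)" for p
  have zero: "g 0 n = 0" for n using add[of 0 0 n] by simp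
  have G0_superset: "G0 p = (\<Sum>n\<in>A. g (Poly_Mapping.lookup p n) n)"
    if "finite A" "Poly_Mapping.keys p \<subseteq> A" for p A
    unfolding G0_def using that
    by (intro sum.mono_neutral_left) (auto simp: zero in_keys_iff)
  have G0_add: "G0 (p + q) = G0 p + G0 q" for p q
  proof -
    let ?A = "Poly_Mapping.keys p \<union> Poly_Mapping.keys q"
    have "G0 (p + q) = (\<Sum>n\<in>?A. g (Poly_Mapping.lookup (p + q) n) n)"
      by (rule G0_superset) (use keys_add[of p q] in auto)
    also have "\<dots> = G0 p + G0 q"
      by (simp add: lookup_add add sum.distrib G0_superset[of ?A])
    finally show ?thesis .
  qed
  have G0_single: "G0 (Poly_Mapping.single n a) = g a n" for n a
    by (simp add: G0_def zero)
  have G0_scale: "G0 (c *\<^sub>C p) = c *\<^sub>C G0 p" for c p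
    by (induction p rule: poly_mapping_single_induct)
      (simp_all add: scaleC_add_right G0_add G0_single scale flip: single_scaleC)
  have der_additive: "laurent_der (p + q) = laurent_der p + laurent_der q"
    and dt_additive: "laurent_dt (p + q) = laurent_dt p + laurent_dt q" for p q :: "int \<Rightarrow>\<^sub>0 'p"
    by (auto intro!: poly_mapping_eqI
        simp: lookup_add lookup_laurent_der laurent_dt.rep_eq der_add scaleC_add_right)
  have G0_range: "G0 (laurent_der h + laurent_dt h) = 0" for h
  proof (induction h rule: poly_mapping_single_induct)
    case (1 n a)
    then show ?case
      by (simp add: laurent_der_single laurent_dt_single G0_add G0_single der scale)
  next
    case (2 p q)
    then show ?case
      by (simp add: der_additive dt_additive G0_add add_eq_0_iff algebra_simps)
  qed
  have G0_null: "G0 h = 0" if "h \<in> tilde_null" for h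
    using that by (auto simp: tilde_null_def G0_range)
  have G0_cong: "G0 p = G0 q" if "abs_tilde p = abs_tilde q" for p q
    using that G0_add[of "p - q" q] by (simp add: abs_tilde_eq_iff G0_null)
  define G where "G x = G0 (rep_tilde x)" for x
  have G_abs: "G (abs_tilde p) = G0 p" for p
    unfolding G_def by (rule G0_cong) (simp add: Quotient3_abs_rep[OF Quotient3_tilde])
  have "G (x + y) = G x + G y" for x y
    by (induction x rule: tilde.abs_induct, induction y rule: tilde.abs_induct)
      (simp add: G_abs G0_add flip: abs_tilde_add)
  moreover have "G (c *\<^sub>C x) = c *\<^sub>C G x" for c x
    by (induction x rule: tilde.abs_induct) (simp add: G_abs scaleC_tilde.abs_eq G0_scale)
  ultimately have "clinear G" by (simp add: clinear_iff)
  moreover have "G (tilde_elem a n) = g a n" for a n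
    by (simp add: tilde_elem_def G_abs G0_single)
  ultimately show thesis by (rule that)
qed


section \<open>Evaluation at monomials in the quotient\<close>

text \<open>
  \<open>lam_eval m (m + n) p\<close> evaluates \<open>p\<close> at \<open>s\<^sup>m t\<^sup>n\<close>, with \<open>\<lambda> = \<partial>\<^sub>s\<close>, and \<open>lam_mu_eval m n (m + n + r) q\<close>
  evaluates \<open>q\<close> at a monomial with exponents \<open>m\<close>, \<open>n\<close>, \<open>r\<close>, with \<open>\<lambda>\<close> and \<open>\<mu>\<close> differentiating the first and
  the second variable. Polynomials in \<open>\<lambda>\<close> and \<open>\<mu>\<close> have the outer variable \<open>\<mu>\<close>, so the second
  evaluation is obtained from the first by one more use of \<^const>\<open>diff_eval\<close>.
\<close>

definition lam_eval :: "int \<Rightarrow> int \<Rightarrow> 'p::cd_module poly \<Rightarrow> 'p tilde" where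
  "lam_eval = diff_eval tilde_elem"

definition lam_mu_eval :: "int \<Rightarrow> int \<Rightarrow> int \<Rightarrow> 'p::cd_module poly poly \<Rightarrow> 'p tilde" where
  "lam_mu_eval m = diff_eval (\<lambda>p N. lam_eval m N p)"

lemma lam_eval_additive: "additive (lam_eval m N)"
  unfolding lam_eval_def by (rule diff_eval_additive[OF tilde_elem_additive])

lemma lam_eval_const: "lam_eval m N [:a:] = tilde_elem a N"
  unfolding lam_eval_def by (rule diff_eval_const[OF tilde_elem_additive])

lemma lam_eval_pCons_0: "lam_eval m N (pCons 0 p) = of_int m *\<^sub>C lam_eval (m - 1) (N - 1) p"
  unfolding lam_eval_def by (rule diff_eval_pCons_0[OF tilde_elem_additive])

lemma lam_eval_scaleC: "lam_eval m N (c *\<^sub>C p) = c *\<^sub>C lam_eval m N p"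
proof -
  have "lam_eval m N (c *\<^sub>C p) = diff_eval (\<lambda>a N. c *\<^sub>C tilde_elem a N) m N p"
    unfolding lam_eval_def scaleC_poly_def
    by (simp add: diff_eval_map_poly[OF tilde_elem_additive] tilde_elem_scaleC)
  also have "\<dots> = c *\<^sub>C lam_eval m N p"
    unfolding lam_eval_def
    by (rule clinear_diff_eval[symmetric]) (simp add: clinear_iff scaleC_add_right mult.commute)
  finally show ?thesis .
qed

text \<open>
  After setting all variables equal, \<open>\<partial>\<close> acts as \<open>-\<partial>\<^sub>t\<close>, which is minus the sum of the derivatives in
  the two variables. Therefore \<open>-\<lambda> - \<partial>\<close> is the derivative in the variable that \<open>\<lambda>\<close> does not
  differentiate; its exponent is \<open>N - m\<close>.
\<close>

lemma lam_eval_minus_lam_minus_der: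
  "lam_eval m N (- pCons 0 p - map_poly \<partial> p) = of_int (N - m) *\<^sub>C lam_eval m (N - 1) p"
proof -
  let ?x = "\<lambda>j. falling m j *\<^sub>C tilde_elem (coeff p j) (N - 1 - int j)"
  have lam: "lam_eval m N (pCons 0 p) = (\<Sum>j\<le>degree p. of_int (m - int j) *\<^sub>C ?x j)"
  proof -
    have "lam_eval m N (pCons 0 p) = (\<Sum>j\<le>degree p.
        (of_int m * falling (m - 1) j) *\<^sub>C tilde_elem (coeff p j) (N - 1 - int j))"
      unfolding lam_eval_pCons_0
      by (simp only: scaleC_scaleC cspace.scale_sum_right lam_eval_def diff_eval_def coeff_sum_def)
    then show ?thesis
      by (simp only: falling_Suc[symmetric] falling_Suc_right scaleC_scaleC)
  qed
  have der: "lam_eval m N (map_poly \<partial> p) = (\<Sum>j\<le>degree p. of_int (int j - N) *\<^sub>C ?x j)"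
  proof -
    have "lam_eval m N (map_poly \<partial> p) =
        (\<Sum>j\<le>degree p. falling m j *\<^sub>C tilde_elem (\<partial> (coeff p j)) (N - int j))"
      unfolding lam_eval_def diff_eval_map_poly[where h = \<partial>, OF tilde_elem_additive der_zero]
      by (simp add: diff_eval_def coeff_sum_def)
    then show ?thesis
      by (simp add: tilde_elem_der mult.commute diff_diff_eq add.commute)
  qed
  have coeff: "- of_int (m - int j) - of_int (int j - N) = (of_int (N - m) :: complex)" for j
    by simp
  have "lam_eval m N (- pCons 0 p - map_poly \<partial> p) =
      (\<Sum>j\<le>degree p. - (of_int (m - int j) *\<^sub>C ?x j) - of_int (int j - N) *\<^sub>C ?x j)"
    unfolding additive.diff[OF lam_eval_additive] additive.minus[OF lam_eval_additive] lam der
    by (simp only: sum_negf sum_subtractf)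
  also have "\<dots> = (\<Sum>j\<le>degree p. of_int (N - m) *\<^sub>C ?x j)"
    by (simp only: coeff flip: cspace.scale_minus_left cspace.scale_left_diff_distrib)
  also have "\<dots> = of_int (N - m) *\<^sub>C lam_eval m (N - 1) p"
    by (simp only: cspace.scale_sum_right lam_eval_def diff_eval_def coeff_sum_def)
  finally show ?thesis .
qed

text \<open>
  Replacing \<open>\<lambda>\<close> by \<open>-\<lambda> - \<partial>\<close> exchanges the two variables, so skew-symmetry and commutativity of a
  conformal algebra become antisymmetry and commutativity on the generators \<open>a\<^sub>m\<close>, \<open>b\<^sub>n\<close>.
\<close>

lemma lam_eval_opposite: "lam_eval m (m + n) (opposite \<partial> f a b) = lam_eval n (m + n) (f b a)"
proof -
  let ?T = "\<lambda>p. - pCons 0 p - map_poly \<partial> p"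
  have "lam_eval m (m + n) ((?T ^^ k) [:x:]) = falling n k *\<^sub>C tilde_elem x (m + n - int k)"
    for k and x :: 'a
  proof -
    have "lam_eval (N - s) N (?T q) = of_int s *\<^sub>C lam_eval (N - 1 - (s - 1)) (N - 1) q"
      for s N and q :: "'a poly"
      by (subst lam_eval_minus_lam_minus_der) simp
    from iterated_derivation[where \<Phi> = "\<lambda>s N. lam_eval (N - s) N" and T = ?T and m = n
        and N = "m + n" and k = k and q = "[:x:]", OF this]
    show ?thesis by (simp only: lam_eval_const add_diff_cancel_right')
  qed
  then show ?thesis
    unfolding opposite_def
    by (subst diff_eval_poly_subst[OF lam_eval_additive]) (simp_all add: lam_eval_def)
qed

lemma lam_mu_eval_additive: "additive (lam_mu_eval m n N)"
  unfolding lam_mu_eval_def by (rule diff_eval_additive[OF lam_eval_additive])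

lemma lam_mu_eval_const2: "lam_mu_eval m n N (const2 a) = tilde_elem a N"
  by (simp add: lam_mu_eval_def const2_def diff_eval_const[OF lam_eval_additive] lam_eval_const)

lemma lam_mu_eval_mult_mu:
  "lam_mu_eval m n N (mult_mu q) = of_int n *\<^sub>C lam_mu_eval m (n - 1) (N - 1) q"
  by (simp add: lam_mu_eval_def mult_mu_def diff_eval_pCons_0[OF lam_eval_additive])

lemma lam_mu_eval_mult_lam:
  "lam_mu_eval m n N (mult_lam q) = of_int m *\<^sub>C lam_mu_eval (m - 1) n (N - 1) q"
proof -
  have "lam_mu_eval m n N (mult_lam q) =
      diff_eval (\<lambda>p N. of_int m *\<^sub>C lam_eval (m - 1) (N - 1) p) n N q"
    unfolding lam_mu_eval_def mult_lam_def
    by (subst diff_eval_map_poly[OF lam_eval_additive]) (simp_all add: lam_eval_pCons_0)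
  also have "\<dots> = of_int m *\<^sub>C diff_eval (\<lambda>p N. lam_eval (m - 1) (N + - 1) p) n N q"
    by (subst clinear_diff_eval[of "scaleC (of_int m)"])
      (simp_all add: clinear_iff scaleC_add_right mult.commute)
  also have "\<dots> = of_int m *\<^sub>C lam_mu_eval (m - 1) n (N - 1) q"
    using diff_eval_shift[of "\<lambda>p N. lam_eval (m - 1) N p" "- 1" n N q]
    by (simp add: lam_mu_eval_def)
  finally show ?thesis .
qed

lemma lam_mu_eval_mult_lam_power:
  "lam_mu_eval m n N ((mult_lam ^^ k) q) = falling m k *\<^sub>C lam_mu_eval (m - int k) n (N - int k) q"
  by (rule iterated_derivation) (rule lam_mu_eval_mult_lam)

lemma lam_mu_eval_mult_mu_power:
  "lam_mu_eval m n N ((mult_mu ^^ k) q) = falling n k *\<^sub>C lam_mu_eval m (n - int k) (N - int k) q"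
  by (rule iterated_derivation[where \<Phi> = "\<lambda>n N. lam_mu_eval m n N"]) (rule lam_mu_eval_mult_mu)

text \<open>
  The binomial theorem for falling factorials (Vandermonde), in the guise that \<open>\<lambda> + \<mu>\<close> is the derivative
  of \<open>s\<^sup>m\<^sup>+\<^sup>n\<close> after the first two variables have been identified.
\<close>

lemma lam_mu_eval_mult_lam_mu_power:
  "lam_mu_eval m n N ((mult_lam_mu ^^ k) (const2 a)) =
    falling (m + n) k *\<^sub>C tilde_elem a (N - int k)"
proof (induction k arbitrary: m n N)
  case (Suc k)
  have "lam_mu_eval m n N ((mult_lam_mu ^^ Suc k) (const2 a)) =
      of_int m *\<^sub>C falling (m - 1 + n) k *\<^sub>C tilde_elem a (N - 1 - int k) +
      of_int n *\<^sub>C falling (m + (n - 1)) k *\<^sub>C tilde_elem a (N - 1 - int k)"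
    by (simp add: mult_lam_mu_def additive.add[OF lam_mu_eval_additive] lam_mu_eval_mult_lam
        lam_mu_eval_mult_mu Suc)
  also have "\<dots> = (of_int (m + n) * falling (m + n - 1) k) *\<^sub>C tilde_elem a (N - 1 - int k)"
  proof -
    have index: "m - 1 + n = m + n - 1" "m + (n - 1) = m + n - 1" by simp_all
    show ?thesis
      unfolding index by (simp add: distrib_right scaleC_add_left)
  qed
  finally show ?case
    by (simp add: falling_Suc diff_diff_eq)
qed (simp add: lam_mu_eval_const2)

lemma lam_mu_eval_subst_lam: "lam_mu_eval m n N (poly_subst const2 mult_lam p) = lam_eval m N p"
  unfolding lam_eval_def
  by (rule diff_eval_poly_subst[OF lam_mu_eval_additive])
    (simp add: lam_mu_eval_mult_lam_power lam_mu_eval_const2)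

lemma lam_mu_eval_subst_mu: "lam_mu_eval m n N (poly_subst const2 mult_mu p) = lam_eval n N p"
  unfolding lam_eval_def
  by (rule diff_eval_poly_subst[OF lam_mu_eval_additive])
    (simp add: lam_mu_eval_mult_mu_power lam_mu_eval_const2)

lemma lam_mu_eval_subst_lam_mu:
  "lam_mu_eval m n N (poly_subst const2 mult_lam_mu p) = lam_eval (m + n) N p"
  unfolding lam_eval_def
  by (rule diff_eval_poly_subst[OF lam_mu_eval_additive]) (rule lam_mu_eval_mult_lam_mu_power)


section \<open>Existence and uniqueness of the operations\<close>

text \<open>
  The coefficient of \<open>\<lambda>\<^sup>j\<close> is the \<open>j\<close>-th product divided by \<open>j!\<close>, which cancels the denominator of the
  binomial coefficient and leaves the falling factorial.
\<close>

lemma tilde_operation_iff: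
  "tilde_operation f B \<longleftrightarrow> cbilinear B \<and>
     (\<forall>a b m n. B (tilde_elem a m) (tilde_elem b n) = lam_eval m (m + n) (f a b))"
  by (simp add: tilde_operation_def lam_eval_def diff_eval_def coeff_sum_def nth_prod_def
      tilde_elem_scaleC falling_def mult.commute)

lemma tilde_operation_elem:
  assumes "tilde_operation f B"
  shows "B (tilde_elem a m) (tilde_elem b n) = lam_eval m (m + n) (f a b)"
  using assms by (simp add: tilde_operation_iff)

lemma tilde_operation_unique:
  assumes "tilde_operation f B" "tilde_operation f B'"
  shows "B = B'"
proof
  fix x
  show "B x = B' x"
  proof (induction x rule: tilde_induct)
    case (elem a m)
    show ?case
      by (rule clinear_tilde_eqI)
        (use assms in \<open>auto simp: cbilinear_def tilde_operation_iff\<close>)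
  next
    case (add x y)
    then show ?case
      using assms by (auto simp: tilde_operation_iff cbilinear_iff)
  qed
qed

text \<open>
  Sesquilinearity in the first and in the second argument are precisely the conditions of
  \<open>tilde_universal\<close> in these arguments. The universal property is first used for fixed \<open>b\<^sub>n\<close>, and
  then once more for the family \<open>G\<close> of linear maps so obtained, which takes values in the complex vector
  space of functions on the quotient.
\<close>

lemma tilde_operation_exists:
  fixes f :: "'p::cd_module \<Rightarrow> 'p \<Rightarrow> 'p poly"
  assumes "conformal_algebra UNIV \<partial> f"
  shows "\<exists>B. tilde_operation f B"
proof -
  interpret conformal_algebra UNIV \<partial> f by fact
  note eval_add = additive.add[OF lam_eval_additive]
  note eval_minus = additive.minus[OF lam_eval_additive]
  have der_left: "lam_eval m (m + n) (f (\<partial> a) b) = - of_int m *\<^sub>C lam_eval (m - 1) (m - 1 + n) (f a b)"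
    for a b m n
    by (simp add: sesqui_left eval_minus lam_eval_pCons_0 algebra_simps)
  have der_right: "lam_eval m (m + n) (f a (\<partial> b)) = - of_int n *\<^sub>C lam_eval m (m + (n - 1)) (f a b)"
    for a b m n
  proof -
    have "f a (\<partial> b) = - (- pCons 0 (f a b) - map_poly \<partial> (f a b))"
      by (simp add: sesqui_right)
    then have "lam_eval m (m + n) (f a (\<partial> b)) =
        - (of_int (m + n - m) *\<^sub>C lam_eval m (m + n - 1) (f a b))"
      by (simp only: eval_minus lam_eval_minus_lam_minus_der)
    then show ?thesis
      by (simp add: add_diff_eq)
  qed
  have "\<forall>b n. \<exists>G. clinear G \<and> (\<forall>a m. G (tilde_elem a m) = lam_eval m (m + n) (f a b))"
  proof (intro allI)
    fix b n
    show "\<exists>G. clinear G \<and> (\<forall>a m. G (tilde_elem a m) = lam_eval m (m + n) (f a b))"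
      by (rule tilde_universal[of "\<lambda>a m. lam_eval m (m + n) (f a b)"])
        (auto simp: add_left scale_left eval_add lam_eval_scaleC der_left)
  qed
  then have "\<exists>G. \<forall>b n. clinear (G b n) \<and>
      (\<forall>a m. G b n (tilde_elem a m) = lam_eval m (m + n) (f a b))"
    by (simp only: choice_iff)
  then obtain G where G: "clinear (G b n)"
      "G b n (tilde_elem a m) = lam_eval m (m + n) (f a b)" for a b m n
    by blast
  obtain H where H: "clinear H" "\<And>b n. H (tilde_elem b n) = G b n"
  proof (rule tilde_universal[of G])
    show "G (b + b') n = G b n + G b' n" for b b' n
      by (rule clinear_tilde_eqI)
        (use G in \<open>simp_all add: clinear_iff scaleC_add_right add_right eval_add algebra_simps\<close>)
    show "G (c *\<^sub>C b) n = c *\<^sub>C G b n" for c b n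
      by (rule clinear_tilde_eqI)
        (use G in \<open>simp_all add: clinear_iff scaleC_fun_def scaleC_add_right scale_right
          lam_eval_scaleC mult.commute\<close>)
    show "G (\<partial> b) n = - of_int n *\<^sub>C G b (n - 1)" for b n
      by (rule clinear_tilde_eqI)
        (use G in \<open>simp_all add: clinear_iff scaleC_fun_def scaleC_add_right der_right mult.commute\<close>)
  qed blast
  have "clinear (H y)" for y
    by (induction y rule: tilde_induct)
      (use G(1) H in \<open>simp_all add: clinear_iff scaleC_add_right algebra_simps\<close>)
  then have "tilde_operation f (\<lambda>x y. H y x)"
    using G H by (auto simp: tilde_operation_iff cbilinear_iff clinear_iff scaleC_fun_def)
  then show ?thesis by (rule exI[of "tilde_operation f"])
qed

lemma tilde_operation_ex1:
  assumes "conformal_algebra UNIV \<partial> f"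
  shows "\<exists>!B. tilde_operation f B"
  using tilde_operation_exists[OF assms] tilde_operation_unique by blast


section \<open>Poisson algebra identities\<close>

text \<open>
  Both bracketings of a product of three generators are evaluations of the corresponding nested
  \<open>\<lambda>\<close>-product. Each identity between nested products in a conformal algebra thus gives the
  identity of the same shape in the quotient.
\<close>

context
  fixes f g :: "'p::cd_module \<Rightarrow> 'p \<Rightarrow> 'p poly" and F G
  assumes F: "tilde_operation f F" and G: "tilde_operation g G"
begin

lemma product_nest_right:
  "F (tilde_elem a m) (G (tilde_elem b n) (tilde_elem c r)) =
     diff_eval (\<lambda>d N. lam_eval m N (f a d)) n (m + n + r) (g b c)"
proof -
  have lin: "clinear (F x)" for x
    using F by (simp add: tilde_operation_iff cbilinear_def)
  show ?thesis
    using diff_eval_shift[of "\<lambda>d N. lam_eval m N (f a d)" m n "n + r" "g b c"]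
    by (simp add: tilde_operation_elem[OF G] lam_eval_def clinear_diff_eval[OF lin])
      (simp add: tilde_operation_elem[OF F] lam_eval_def algebra_simps)
qed

lemma product_eq_nest_right:
  "F (tilde_elem a m) (G (tilde_elem b n) (tilde_elem c r)) =
     lam_mu_eval m n (m + n + r) (nest_right f g a mult_lam b mult_mu c)"
  unfolding nest_right_def product_nest_right
  by (rule diff_eval_poly_subst[OF lam_mu_eval_additive, symmetric])
    (simp add: lam_mu_eval_mult_mu_power lam_mu_eval_subst_lam)

lemma product_eq_nest_right_swapped:
  "F (tilde_elem b n) (G (tilde_elem a m) (tilde_elem c r)) =
     lam_mu_eval m n (m + n + r) (nest_right f g b mult_mu a mult_lam c)"
  unfolding nest_right_def product_nest_right add.commute[of n m]
  by (rule diff_eval_poly_subst[OF lam_mu_eval_additive, symmetric])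
    (simp add: lam_mu_eval_mult_lam_power lam_mu_eval_subst_mu)

lemma product_eq_nest_left:
  "F (G (tilde_elem a m) (tilde_elem b n)) (tilde_elem c r) =
     lam_mu_eval m n (m + n + r) (nest_left f g a mult_lam b mult_lam_mu c)"
proof -
  have lin: "clinear (\<lambda>x. F x y)" for y
    using F by (simp add: tilde_operation_iff cbilinear_def)
  have "F (G (tilde_elem a m) (tilde_elem b n)) (tilde_elem c r) =
      diff_eval (\<lambda>d N. lam_eval (N - r) N (f d c)) m (m + n + r) (g a b)"
    using diff_eval_shift[of "\<lambda>d N. lam_eval (N - r) N (f d c)" r m "m + n" "g a b"]
    by (simp add: tilde_operation_elem[OF G] lam_eval_def clinear_diff_eval[OF lin])
      (simp add: tilde_operation_elem[OF F] lam_eval_def algebra_simps)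
  (* On the right, lambda lowers m and the total degree N alike, so m + n is N - r throughout. *)
  also have "\<dots> = lam_mu_eval m n (m + n + r) (nest_left f g a mult_lam b mult_lam_mu c)"
    unfolding nest_left_def
    by (rule diff_eval_poly_subst[OF lam_mu_eval_additive, symmetric])
      (simp add: lam_mu_eval_mult_lam_power lam_mu_eval_subst_lam_mu algebra_simps)
  finally show ?thesis .
qed

end

lemma tilde_operation_antisym:
  assumes "lie_conformal_algebra UNIV \<partial> f" and B: "tilde_operation f B"
  shows "B x y = - B y x"
proof -
  interpret lie_conformal_algebra UNIV \<partial> f by fact
  note add = additive.add[OF cbilinear_additive(1)] additive.add[OF cbilinear_additive(2)]
  have bil: "cbilinear B" using B by (simp add: tilde_operation_def)
  show ?thesis
  proof (induction x rule: tilde_induct)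
    case (elem a m)
    show ?case
    proof (induction y rule: tilde_induct)
      case (elem b n)
      have "lam_eval m (m + n) (f a b) = - lam_eval n (n + m) (f b a)"
        using skew[of a b] lam_eval_opposite[of m n f a b]
        by (simp add: additive.minus[OF lam_eval_additive] add.commute)
      then show ?case by (simp add: tilde_operation_elem[OF B])
    qed (simp add: add[OF bil])
  qed (simp add: add[OF bil])
qed

lemma tilde_operation_commute:
  assumes "\<And>a b. f a b = opposite \<partial> f a b" and B: "tilde_operation f B"
  shows "B x y = B y x"
proof -
  note add = additive.add[OF cbilinear_additive(1)] additive.add[OF cbilinear_additive(2)]
  have bil: "cbilinear B" using B by (simp add: tilde_operation_def)
  show ?thesis
  proof (induction x rule: tilde_induct)
    case (elem a m)
    show ?case
    proof (induction y rule: tilde_induct)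
      case (elem b n)
      show ?case
        using assms(1)[of a b] lam_eval_opposite[of m n f a b]
        by (simp add: tilde_operation_elem[OF B] add.commute)
    qed (simp add: add[OF bil])
  qed (simp add: add[OF bil])
qed

lemma tilde_induct3:
  assumes "\<And>a m b n c r. P (tilde_elem a m) (tilde_elem b n) (tilde_elem c r)"
    and "\<And>x x' y z. P x y z \<Longrightarrow> P x' y z \<Longrightarrow> P (x + x') y z"
    and "\<And>x y y' z. P x y z \<Longrightarrow> P x y' z \<Longrightarrow> P x (y + y') z"
    and "\<And>x y z z'. P x y z \<Longrightarrow> P x y z' \<Longrightarrow> P x y (z + z')"
  shows "P x y z"
proof (induction x rule: tilde_induct)
  case (elem a m)
  show ?case
  proof (induction y rule: tilde_induct)
    case (elem b n)
    show ?case by (induction z rule: tilde_induct) (auto intro: assms)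
  qed (auto intro: assms)
qed (auto intro: assms)

text \<open>
  The axioms of \<open>P\<close> are evaluated on generators. The conformal Jacobi identity gives the Jacobi
  identity in the form \<open>[x, [y, z]] = [[x, y], z] + [y, [x, z]]\<close>, from which the cyclic form follows by
  antisymmetry.
\<close>

lemma nc_poisson_algebra_tilde:
  assumes "nc_poisson_conformal_algebra UNIV \<partial> circ lbrk"
    and M: "tilde_operation circ M" and B: "tilde_operation lbrk B"
  shows "nc_poisson_algebra M B"
proof -
  interpret nc_poisson_conformal_algebra UNIV \<partial> circ lbrk by fact
  have bilM: "cbilinear M" and bilB: "cbilinear B"
    using M B by (simp_all add: tilde_operation_def)
  note add = additive.add[OF cbilinear_additive(1)] additive.add[OF cbilinear_additive(2)]
  note eval_add = additive.add[OF lam_mu_eval_additive]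
  have anti: "B x y = - B y x" for x y
    by (rule tilde_operation_antisym[OF brk.lie_conformal_algebra_axioms B])
  have minus: "B x (- y) = - B x y" for x y
    by (rule additive.minus[OF cbilinear_additive(1)[OF bilB]])
  show ?thesis
  proof
    show "cbilinear M" "cbilinear B" by fact+
    show "M (M x y) z = M x (M y z)" for x y z
      by (induction x y z rule: tilde_induct3)
        (simp_all add: add[OF bilM] product_eq_nest_right[OF M M] product_eq_nest_left[OF M M]
          mul.assoc)
    show "B x x = 0" for x
    proof -
      have "B x x + B x x = 0"
        using anti[of x x] by (simp add: eq_neg_iff_add_eq_0)
      then have "(2 :: complex) *\<^sub>C B x x = 0"
        using scaleC_add_left[of 1 1 "B x x"] by simp
      then show ?thesis by simp
    qed
    have jacobi: "B x (B y z) = B (B x y) z + B y (B x z)" for x y z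
    proof (induction x y z rule: tilde_induct3)
      case (1 a m b n c r)
      show ?case
        unfolding product_eq_nest_right[OF B B, of a m b n c r] product_eq_nest_left[OF B B]
          product_eq_nest_right_swapped[OF B B, of b n a m c r]
        by (simp add: brk.jacobi eval_add)
    qed (simp_all add: add[OF bilB])
    show "B x (B y z) + B y (B z x) + B z (B x y) = 0" for x y z
      using jacobi[of x y z] anti[of z x] anti[of z "B x y"] by (simp add: minus)
    show "B x (M y z) = M (B x y) z + M y (B x z)" for x y z
      by (induction x y z rule: tilde_induct3)
        (simp_all add: add[OF bilB] add[OF bilM] product_eq_nest_right[OF B M]
          product_eq_nest_left[OF M B] product_eq_nest_right_swapped[OF M B] leibniz eval_add)
  qed
qed


section \<open>Locality\<close>

lemma gbinomial_of_int_diff: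
  "((of_int (m + 1) :: complex) gchoose Suc j) - (of_int m gchoose Suc j) = of_int m gchoose j"
  by (simp add: gbinomial_Suc_Suc)

text \<open>
  Multiplication by \<open>z - w\<close> takes differences of binomial coefficients in \<open>m\<close>. By Pascal's rule this
  replaces the binomial coefficient over \<open>j + 1\<close> by the one over \<open>j\<close>, so that the sequence of products
  \<open>a\<^sub>(\<^sub>j\<^sub>)b\<close> is shifted by one. As only finitely many of them are nonzero, some power of \<open>z - w\<close> kills
  everything; and at \<open>m = 0\<close>, where only the summand with \<open>j = 0\<close> survives, the \<open>k\<close>-th power yields
  \<open>a\<^sub>(\<^sub>k\<^sub>)b\<close>.
\<close>

lemma mult_z_minus_w_power_tilde:
  assumes B: "tilde_operation f B"
  shows "(mult_z_minus_w ^^ k) (dist_op B (tilde_elem a) (tilde_elem b)) m n =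
    (\<Sum>j\<le>degree (f a b). ((of_int m :: complex) gchoose j) *\<^sub>C
       tilde_elem (nth_prod f (j + k) a b) (m + n - int j))"
proof (induction k arbitrary: m n)
  case 0
  show ?case using B by (simp add: dist_op_def tilde_operation_def)
next
  case (Suc k)
  let ?K = "degree (f a b)"
  let ?x = "\<lambda>j. tilde_elem (nth_prod f (j + k) a b) (m + n + 1 - int j)"
  have "(mult_z_minus_w ^^ Suc k) (dist_op B (tilde_elem a) (tilde_elem b)) m n =
      (\<Sum>j\<le>?K. ((of_int (m + 1) :: complex) gchoose j) *\<^sub>C ?x j) -
      (\<Sum>j\<le>?K. ((of_int m :: complex) gchoose j) *\<^sub>C ?x j)"
  proof -
    have index: "m + 1 + n - int j = m + n + 1 - int j" "m + (n + 1) - int j = m + n + 1 - int j"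
      for j by simp_all
    show ?thesis
      unfolding funpow.simps comp_apply mult_z_minus_w_def[of "(mult_z_minus_w ^^ k) _"] Suc.IH index ..
  qed
  also have "\<dots> = (\<Sum>j\<le>?K. ((of_int (m + 1) gchoose j) - ((of_int m :: complex) gchoose j)) *\<^sub>C ?x j)"
    by (simp only: cspace.scale_left_diff_distrib sum_subtractf)
  (* The added summand vanishes, as its product lies beyond the degree; it makes room for the shift. *)
  also have "\<dots> =
      (\<Sum>j\<le>Suc ?K. ((of_int (m + 1) gchoose j) - ((of_int m :: complex) gchoose j)) *\<^sub>C ?x j)"
    by (simp add: nth_prod_def coeff_eq_0 additive.zero[OF tilde_elem_additive])
  also have "\<dots> = (\<Sum>j\<le>?K. ((of_int m :: complex) gchoose j) *\<^sub>C ?x (Suc j))"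
    by (simp only: sum.atMost_Suc_shift gbinomial_of_int_diff) simp
  also have "\<dots> = (\<Sum>j\<le>?K. ((of_int m :: complex) gchoose j) *\<^sub>C
      tilde_elem (nth_prod f (j + Suc k) a b) (m + n - int j))"
    by (simp add: add_diff_eq)
  finally show ?case .
qed

lemma mult_z_minus_w_power_tilde_eq_0:
  assumes "tilde_operation f B" and "degree (f a b) < k"
  shows "(mult_z_minus_w ^^ k) (dist_op B (tilde_elem a) (tilde_elem b)) = 0"
  using assms by (simp add: fun_eq_iff mult_z_minus_w_power_tilde nth_prod_def coeff_eq_0
      additive.zero[OF tilde_elem_additive])

lemma local_pair_tilde:
  assumes "tilde_operation f M" "tilde_operation g B"
  shows "local_pair M B (tilde_elem a) (tilde_elem b)"
proof -
  let ?N = "Suc (degree (f a b) + degree (f b a) + degree (g a b))"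
  show ?thesis
    unfolding local_pair_def
    by (intro exI[of _ ?N] conjI mult_z_minus_w_power_tilde_eq_0[OF assms(1)]
        mult_z_minus_w_power_tilde_eq_0[OF assms(2)]) simp_all
qed

lemma dist_prod_tilde:
  assumes "tilde_operation f B"
  shows "dist_prod B k (tilde_elem a) (tilde_elem b) = tilde_elem (nth_prod f k a b)"
proof
  fix n
  have "dist_prod B k (tilde_elem a) (tilde_elem b) n =
      (\<Sum>j\<le>degree (f a b). if j = 0 then tilde_elem (nth_prod f k a b) n else 0)"
    unfolding dist_prod_def Res_z_def mult_z_minus_w_power_tilde[OF assms]
    by (intro sum.cong) (auto simp: gbinomial_0_left)
  then show "dist_prod B k (tilde_elem a) (tilde_elem b) n = tilde_elem (nth_prod f k a b) n"
    by simp
qed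

text \<open>
  The factorials in \<^const>\<open>nth_prod\<close> and \<^const>\<open>dist_lam_prod\<close> cancel, so the coefficient function is
  that of a polynomial, and \<^const>\<open>Abs_poly\<close> recovers this polynomial.
\<close>

lemma dist_lam_prod_tilde:
  assumes "tilde_operation f B"
  shows "dist_lam_prod B (tilde_elem a) (tilde_elem b) = map_poly tilde_elem (f a b)"
proof -
  have "(1 / fact n) *\<^sub>C dist_prod B n (tilde_elem a) (tilde_elem b) = tilde_elem (coeff (f a b) n)" for n
    by (simp add: dist_prod_tilde[OF assms] nth_prod_def fun_eq_iff scaleC_fun_def tilde_elem_scaleC)
  moreover have "tilde_elem (0::'a) = 0"
    by (simp add: fun_eq_iff additive.zero[OF tilde_elem_additive])
  ultimately have "(\<lambda>n. (1 / fact n) *\<^sub>C dist_prod B n (tilde_elem a) (tilde_elem b)) =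
      coeff (map_poly tilde_elem (f a b))"
    by (simp add: coeff_map_poly fun_eq_iff)
  then show ?thesis
    by (simp add: dist_lam_prod_def coeff_inverse)
qed

lemma tilde_dists_subspace: "cspace.subspace (tilde_dists :: 'p::cd_module tilde fdist set)"
proof (rule cspace.subspaceI)
  have eqs: "0 = tilde_elem (0::'p)" "tilde_elem a + tilde_elem b = tilde_elem (a + b)"
    "c *\<^sub>C tilde_elem a = tilde_elem (c *\<^sub>C a)" for a b :: 'p and c
    by (simp_all add: fun_eq_iff additive.zero[OF tilde_elem_additive] tilde_elem_add
        tilde_elem_scaleC scaleC_fun_def)
  show "0 \<in> (tilde_dists :: 'p tilde fdist set)"
    unfolding tilde_dists_def eqs(1) by simp
  show "x + y \<in> tilde_dists" if "x \<in> tilde_dists" "y \<in> tilde_dists" for x y :: "'p tilde fdist"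
    using that by (auto simp: tilde_dists_def eqs)
  show "c *\<^sub>C x \<in> tilde_dists" if "x \<in> tilde_dists" for c and x :: "'p tilde fdist"
    using that by (auto simp: tilde_dists_def eqs)
qed

text \<open>
  The products of \<open>a(z)\<close> and \<open>b(z)\<close> are the distributions of the products in \<open>P\<close>, so the
  given family is closed under all operations and equals its own closure.
\<close>

lemma dist_closure_tilde:
  assumes "tilde_operation f M" "tilde_operation g B"
  shows "dist_closure M B tilde_dists = tilde_dists"
proof
  show "dist_closure M B tilde_dists \<subseteq> tilde_dists"
    unfolding dist_closure_def
  proof (intro Inter_lower CollectI conjI)
    show "\<forall>a\<in>tilde_dists. deriv_z a \<in> tilde_dists"
      by (auto simp: tilde_dists_def deriv_z_tilde_elem)
    show "\<forall>a\<in>tilde_dists. \<forall>b\<in>tilde_dists. \<forall>j.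
        dist_prod M j a b \<in> tilde_dists \<and> dist_prod B j a b \<in> tilde_dists"
      by (auto simp: tilde_dists_def dist_prod_tilde[OF assms(1)] dist_prod_tilde[OF assms(2)])
  qed (use tilde_dists_subspace in auto)
qed (auto simp: dist_closure_def)

lemma span_fourier_coefficients:
  "cspace.span {a n | a n. a \<in> tilde_dists} = (UNIV :: 'p::cd_module tilde set)"
proof -
  have "x \<in> cspace.span {a n | a n. a \<in> tilde_dists}" for x :: "'p tilde"
  proof (induction x rule: tilde_induct)
    case (elem a n)
    show ?case
      by (rule cspace.span_base) (auto simp: tilde_dists_def)
  qed (rule cspace.span_add)
  then show ?thesis by blast
qed


section \<open>Transport of structure\<close>

text \<open>
  An injective linear map commuting with the derivations makes its range a copy of the domain.
  Injectivity makes \<open>map_poly \<theta>\<close> preserve degrees, so that \<^const>\<open>poly_subst\<close>, which sums up to the degree,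
  can be transported term by term.
\<close>

locale conformal_embedding =
  fixes \<theta> :: "'a::complex_space \<Rightarrow> 'b::complex_space"
    and D :: "'a \<Rightarrow> 'a" and D' :: "'b \<Rightarrow> 'b"
  assumes inj: "inj \<theta>"
    and add: "\<theta> (x + y) = \<theta> x + \<theta> y"
    and scale: "\<theta> (c *\<^sub>C x) = c *\<^sub>C \<theta> x"
    and der: "D' (\<theta> x) = \<theta> (D x)"
    and D_0: "D 0 = 0"
begin

abbreviation map1 :: "'a poly \<Rightarrow> 'b poly" where "map1 \<equiv> map_poly \<theta>"
abbreviation map2 :: "'a poly poly \<Rightarrow> 'b poly poly" where "map2 \<equiv> map_poly map1"

sublocale additive \<theta>
  by unfold_locales (rule add)

lemma coeff_map1: "coeff (map1 p) n = \<theta> (coeff p n)"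
  by (rule coeff_map_poly[where f = \<theta>, OF zero])

lemma coeff_map2: "coeff (map2 p) n = map1 (coeff p n)"
  by (simp add: coeff_map_poly)

lemma map1_additive: "additive map1"
  by unfold_locales (simp add: poly_eq_iff coeff_map1 add)

lemma map2_additive: "additive map2"
  by unfold_locales (simp add: poly_eq_iff coeff_map2 coeff_map1 add)

lemma degree_map1: "degree (map1 p) = degree p"
  by (rule degree_map_poly) (use inj zero in \<open>metis injD\<close>)

lemma D'_0: "D' 0 = 0"
  using der[of 0] by (simp add: zero D_0)

lemma map1_pCons_0: "map1 (pCons 0 p) = pCons 0 (map1 p)"
  by (simp add: map_poly_pCons zero)

lemma map2_pCons_0: "map2 (pCons 0 p) = pCons 0 (map2 p)"
  by (simp add: map_poly_pCons)

lemma map_poly_D': "map_poly D' (map1 p) = map1 (map_poly D p)"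
  by (rule poly_eqI) (simp add: coeff_map_poly coeff_map1 D_0 D'_0 der)

lemma map1_scaleC: "map1 (c *\<^sub>C p) = c *\<^sub>C map1 p"
  by (simp add: poly_eq_iff coeff_map1 scaleC_poly_def coeff_map_poly scale)

lemma map2_mult_lam: "mult_lam (map2 q) = map2 (mult_lam q)"
  by (rule poly_eqI) (simp add: mult_lam_def coeff_map_poly coeff_map2 map1_pCons_0)

lemma map2_mult_mu: "mult_mu (map2 q) = map2 (mult_mu q)"
  by (simp add: mult_mu_def map2_pCons_0)

lemma map2_mult_lam_mu: "mult_lam_mu (map2 q) = map2 (mult_lam_mu q)"
  by (simp add: mult_lam_mu_def map2_mult_lam map2_mult_mu additive.add[OF map2_additive])

lemma map2_const2: "const2 (\<theta> a) = map2 (const2 a)"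
  by (simp add: const2_def map_poly_pCons zero)

lemma poly_subst_map1:
  assumes "additive \<Theta>" and "\<And>x. h' (\<theta> x) = \<Theta> (h x)" and T: "\<And>q. T' (\<Theta> q) = \<Theta> (T q)"
  shows "poly_subst h' T' (map1 p) = \<Theta> (poly_subst h T p)"
proof -
  have "(T' ^^ k) (\<Theta> q) = \<Theta> ((T ^^ k) q)" for k q
    by (induction k) (simp_all add: T)
  then show ?thesis
    by (simp add: poly_subst_def degree_map1 coeff_map1 assms(2) additive.sum[OF assms(1)])
qed

lemma nest_right_map:
  assumes f: "\<And>a b. f' (\<theta> a) (\<theta> b) = map1 (f a b)" and g: "\<And>a b. g' (\<theta> a) (\<theta> b) = map1 (g a b)"
    and S: "\<And>q. S' (map2 q) = map2 (S q)" and T: "\<And>q. T' (map2 q) = map2 (T q)"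
  shows "nest_right f' g' (\<theta> a) S' (\<theta> b) T' (\<theta> c) = map2 (nest_right f g a S b T c)"
  unfolding nest_right_def g
  by (intro poly_subst_map1[OF map2_additive] T)
    (unfold f, intro poly_subst_map1[OF map2_additive] S map2_const2)

lemma nest_left_map:
  assumes f: "\<And>a b. f' (\<theta> a) (\<theta> b) = map1 (f a b)" and g: "\<And>a b. g' (\<theta> a) (\<theta> b) = map1 (g a b)"
    and S: "\<And>q. S' (map2 q) = map2 (S q)" and T: "\<And>q. T' (map2 q) = map2 (T q)"
  shows "nest_left f' g' (\<theta> a) S' (\<theta> b) T' (\<theta> c) = map2 (nest_left f g a S b T c)"
  unfolding nest_left_def g
  by (intro poly_subst_map1[OF map2_additive] S)
    (unfold f, intro poly_subst_map1[OF map2_additive] T map2_const2)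

lemma opposite_map:
  assumes f: "\<And>a b. f' (\<theta> a) (\<theta> b) = map1 (f a b)"
  shows "opposite D' f' (\<theta> a) (\<theta> b) = map1 (opposite D f a b)"
  unfolding opposite_def f
  by (rule poly_subst_map1[OF map1_additive])
    (simp_all add: map_poly_pCons zero map_poly_D' map1_pCons_0
      additive.diff[OF map1_additive] additive.minus[OF map1_additive])

lemma conformal_algebra_range:
  assumes "conformal_algebra UNIV D f" and f: "\<And>a b. f' (\<theta> a) (\<theta> b) = map1 (f a b)"
  shows "conformal_algebra (range \<theta>) D' f'"
proof -
  interpret A: conformal_algebra UNIV D f by fact
  note simps = f der map1_scaleC additive.add[OF map1_additive] additive.minus[OF map1_additive]
    map1_pCons_0 map_poly_D' coeff_map1
  note backwards = add[symmetric] scale[symmetric]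
  have zero_in: "0 \<in> range \<theta>" using zero by (metis rangeI)
  show ?thesis
  proof
    show "cspace.subspace (range \<theta>)"
      by (rule cspace.subspaceI) (auto simp: zero_in backwards)
  qed (auto simp: backwards,
      auto simp: simps A.D_add A.D_scale A.add_left A.add_right
      A.scale_left A.scale_right A.sesqui_left A.sesqui_right, auto simp: add scale)
qed

lemma nc_poisson_conformal_algebra_range:
  assumes "nc_poisson_conformal_algebra UNIV D m l"
    and m: "\<And>a b. m' (\<theta> a) (\<theta> b) = map1 (m a b)" and l: "\<And>a b. l' (\<theta> a) (\<theta> b) = map1 (l a b)"
  shows "nc_poisson_conformal_algebra (range \<theta>) D' m' l'"
proof -
  interpret A: nc_poisson_conformal_algebra UNIV D m l by fact
  interpret M: conformal_algebra "range \<theta>" D' m'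
    by (rule conformal_algebra_range[OF A.mul.conformal_algebra_axioms m])
  interpret L: conformal_algebra "range \<theta>" D' l'
    by (rule conformal_algebra_range[OF A.brk.conformal_algebra_axioms l])
  note maps = map2_mult_lam map2_mult_mu map2_mult_lam_mu
  note add2 = additive.add[OF map2_additive, symmetric]
  show ?thesis
  proof
    fix a b c
    assume "a \<in> range \<theta>" "b \<in> range \<theta>" "c \<in> range \<theta>"
    then obtain x y z where [simp]: "a = \<theta> x" "b = \<theta> y" "c = \<theta> z" by blast
    show "nest_right m' m' a mult_lam b mult_mu c = nest_left m' m' a mult_lam b mult_lam_mu c"
      by (simp add: nest_right_map[where f = m and g = m, OF m m]
          nest_left_map[where f = m and g = m, OF m m] maps A.mul.assoc)
    show "nest_right l' l' a mult_lam b mult_mu c =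
        nest_left l' l' a mult_lam b mult_lam_mu c + nest_right l' l' b mult_mu a mult_lam c"
      by (simp add: nest_right_map[where f = l and g = l, OF l l]
          nest_left_map[where f = l and g = l, OF l l] maps add2)
         (subst A.brk.jacobi, simp_all)
    show "nest_right l' m' a mult_lam b mult_mu c =
        nest_left m' l' a mult_lam b mult_lam_mu c + nest_right m' l' b mult_mu a mult_lam c"
      by (simp add: nest_right_map[where f = l and g = m, OF l m] nest_right_map[where f = m and g = l, OF m l]
          nest_left_map[where f = m and g = l, OF m l] maps add2 A.leibniz)
  next
    fix a b
    assume "a \<in> range \<theta>" "b \<in> range \<theta>"
    then obtain x y where [simp]: "a = \<theta> x" "b = \<theta> y" by blast
    have "l x y = - opposite D l x y" by (rule A.brk.skew) simp_all
    then have "map1 (l x y) = - map1 (opposite D l x y)"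
      by (metis additive.minus[OF map1_additive])
    then show "l' a b = - opposite D' l' a b"
      by (simp add: l opposite_map[where f = l, OF l])
  qed
qed

lemma poisson_conformal_algebra_range:
  assumes "poisson_conformal_algebra UNIV D m l"
    and m: "\<And>a b. m' (\<theta> a) (\<theta> b) = map1 (m a b)" and l: "\<And>a b. l' (\<theta> a) (\<theta> b) = map1 (l a b)"
  shows "poisson_conformal_algebra (range \<theta>) D' m' l'"
proof -
  interpret A: poisson_conformal_algebra UNIV D m l by fact
  interpret nc_poisson_conformal_algebra "range \<theta>" D' m' l'
    by (rule nc_poisson_conformal_algebra_range[OF A.nc_poisson_conformal_algebra_axioms m l])
  show ?thesis
  proof
    fix a b
    assume "a \<in> range \<theta>" "b \<in> range \<theta>"
    then obtain x y where "a = \<theta> x" "b = \<theta> y" by blast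
    moreover have "m x y = opposite D m x y" by (rule A.commutative) simp_all
    ultimately show "m' a b = opposite D' m' a b"
      by (simp add: m opposite_map[where f = m, OF m] flip: \<open>m x y = _\<close>)
  qed
qed

lemma poisson_conformal_iso_inv:
  assumes m: "\<And>a b. m' (\<theta> a) (\<theta> b) = map1 (m a b)" and l: "\<And>a b. l' (\<theta> a) (\<theta> b) = map1 (l a b)"
  shows "poisson_conformal_iso (range \<theta>) D' m' l' UNIV D m l (inv \<theta>)"
proof -
  have inv: "inv \<theta> (\<theta> x) = x" for x by (rule inv_f_f[OF inj])
  have inv_0: "inv \<theta> 0 = 0" using inv[of 0] by (simp add: zero)
  have inv_poly: "map_poly (inv \<theta>) (map1 p) = p" for p
    by (rule poly_eqI) (simp add: coeff_map_poly[where f = "inv \<theta>", OF inv_0] coeff_map1 inv)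
  have inv_add: "inv \<theta> (\<theta> x + \<theta> y) = x + y" and inv_scale: "inv \<theta> (c *\<^sub>C \<theta> x) = c *\<^sub>C x" for x y c
    by (simp_all add: inv flip: add scale)
  show ?thesis
    unfolding poisson_conformal_iso_def
    by (auto simp: inv inv_add inv_scale der m l inv_poly bij_betw_def inj_on_def image_image)
qed

end

lemma tilde_conformal_embedding:
  "conformal_embedding (tilde_elem :: 'p::cd_module \<Rightarrow> 'p tilde fdist) \<partial> deriv_z"
  by unfold_locales
    (simp_all add: tilde_elem_inj fun_eq_iff tilde_elem_add tilde_elem_scaleC scaleC_fun_def
      deriv_z_tilde_elem der_zero)

theorem theorem3p9:
  fixes circ brk :: "'p::cd_module \<Rightarrow> 'p \<Rightarrow> 'p poly"
  shows
    "(nc_poisson_conformal_algebra UNIV \<partial> circ brk \<longrightarrow>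
       (\<exists>!M. tilde_operation circ M) \<and> (\<exists>!B. tilde_operation brk B) \<and>
       (\<forall>M B. tilde_operation circ M \<and> tilde_operation brk B \<longrightarrow>
          nc_poisson_algebra M B \<and>
          (\<forall>a\<in>tilde_dists. \<forall>b\<in>tilde_dists. local_pair M B a b) \<and>
          nc_formal_dist_poisson_algebra M B tilde_dists \<and>
          nc_poisson_conformal_algebra
            (dist_closure M B tilde_dists) deriv_z (dist_lam_prod M) (dist_lam_prod B) \<and>
          (\<exists>\<phi>. poisson_conformal_iso
            (dist_closure M B tilde_dists) deriv_z (dist_lam_prod M) (dist_lam_prod B)
            UNIV \<partial> circ brk \<phi>))) \<and>
     (poisson_conformal_algebra UNIV \<partial> circ brk \<longrightarrow>
       (\<exists>!M. tilde_operation circ M) \<and> (\<exists>!B. tilde_operation brk B) \<and>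
       (\<forall>M B. tilde_operation circ M \<and> tilde_operation brk B \<longrightarrow>
          poisson_algebra M B \<and>
          (\<forall>a\<in>tilde_dists. \<forall>b\<in>tilde_dists. local_pair M B a b) \<and>
          formal_dist_poisson_algebra M B tilde_dists \<and>
          poisson_conformal_algebra
            (dist_closure M B tilde_dists) deriv_z (dist_lam_prod M) (dist_lam_prod B) \<and>
          (\<exists>\<phi>. poisson_conformal_iso
            (dist_closure M B tilde_dists) deriv_z (dist_lam_prod M) (dist_lam_prod B)
            UNIV \<partial> circ brk \<phi>)))"
proof -
  interpret \<theta>: conformal_embedding "tilde_elem :: 'p \<Rightarrow> _" \<partial> deriv_z
    by (rule tilde_conformal_embedding)
  have ex1: "(\<exists>!M. tilde_operation circ M) \<and> (\<exists>!B. tilde_operation brk B)"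
    if "nc_poisson_conformal_algebra UNIV \<partial> circ brk"
  proof -
    interpret nc_poisson_conformal_algebra UNIV \<partial> circ brk by fact
    show ?thesis
      using mul.conformal_algebra_axioms brk.conformal_algebra_axioms
      by (simp add: tilde_operation_ex1)
  qed
  have local: "\<forall>a\<in>tilde_dists. \<forall>b\<in>tilde_dists. local_pair M B a b"
    and iso: "\<exists>\<phi>. poisson_conformal_iso
      (dist_closure M B tilde_dists) deriv_z (dist_lam_prod M) (dist_lam_prod B)
      UNIV \<partial> circ brk \<phi>"
    and con: "nc_poisson_conformal_algebra UNIV \<partial> circ brk \<Longrightarrow> nc_poisson_conformal_algebra
      (dist_closure M B tilde_dists) deriv_z (dist_lam_prod M) (dist_lam_prod B)"
    and con_comm: "poisson_conformal_algebra UNIV \<partial> circ brk \<Longrightarrow> poisson_conformal_algebra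
      (dist_closure M B tilde_dists) deriv_z (dist_lam_prod M) (dist_lam_prod B)"
    and formal: "nc_poisson_conformal_algebra UNIV \<partial> circ brk \<Longrightarrow>
      nc_formal_dist_poisson_algebra M B tilde_dists"
    and formal_comm: "poisson_conformal_algebra UNIV \<partial> circ brk \<Longrightarrow>
      formal_dist_poisson_algebra M B tilde_dists"
    if M: "tilde_operation circ M" and B: "tilde_operation brk B" for M B
  proof -
    have closure: "dist_closure M B tilde_dists = range tilde_elem"
      using dist_closure_tilde[OF M B] by (simp add: tilde_dists_def)
    note prods = dist_lam_prod_tilde[OF M] dist_lam_prod_tilde[OF B]
    show local: "\<forall>a\<in>tilde_dists. \<forall>b\<in>tilde_dists. local_pair M B a b"
      using local_pair_tilde[OF M B] by (auto simp: tilde_dists_def)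
    show "\<exists>\<phi>. poisson_conformal_iso
        (dist_closure M B tilde_dists) deriv_z (dist_lam_prod M) (dist_lam_prod B)
        UNIV \<partial> circ brk \<phi>"
      unfolding closure using \<theta>.poisson_conformal_iso_inv[where m = circ and l = brk, OF prods] by blast
    show formal: "nc_formal_dist_poisson_algebra M B tilde_dists"
      if "nc_poisson_conformal_algebra UNIV \<partial> circ brk"
    proof (intro nc_formal_dist_poisson_algebra.intro nc_formal_dist_poisson_algebra_axioms.intro)
      show "nc_poisson_algebra M B"
        by (rule nc_poisson_algebra_tilde[OF that M B])
    qed (use local in blast, rule span_fourier_coefficients)
    show "nc_poisson_conformal_algebra
        (dist_closure M B tilde_dists) deriv_z (dist_lam_prod M) (dist_lam_prod B)"
      if "nc_poisson_conformal_algebra UNIV \<partial> circ brk"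
      unfolding closure by (rule \<theta>.nc_poisson_conformal_algebra_range[OF that prods])
    show "poisson_conformal_algebra
        (dist_closure M B tilde_dists) deriv_z (dist_lam_prod M) (dist_lam_prod B)"
      if "poisson_conformal_algebra UNIV \<partial> circ brk"
      unfolding closure by (rule \<theta>.poisson_conformal_algebra_range[OF that prods])
    show "formal_dist_poisson_algebra M B tilde_dists"
      if "poisson_conformal_algebra UNIV \<partial> circ brk"
    proof -
      interpret P: poisson_conformal_algebra UNIV \<partial> circ brk by fact
      interpret nc_formal_dist_poisson_algebra M B tilde_dists
        by (rule formal[OF P.nc_poisson_conformal_algebra_axioms])
      show ?thesis
        by unfold_locales (rule tilde_operation_commute[OF P.commutative M]; simp)
    qed
  qed
  show ?thesis (is "(_ \<longrightarrow> ?noncommutative) \<and> (_ \<longrightarrow> ?commutative)")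
  proof (rule conjI; rule impI)
    assume P: "nc_poisson_conformal_algebra UNIV \<partial> circ brk"
    show ?noncommutative
    proof (intro conjI allI impI)
      show "\<exists>!M. tilde_operation circ M" "\<exists>!B. tilde_operation brk B"
        using ex1[OF P] by (rule conjunct1, rule conjunct2)
    qed (use nc_poisson_algebra_tilde[OF P] local iso con[OF _ _ P] formal[OF _ _ P] in \<open>elim conjE; blast\<close>)+
  next
    assume P: "poisson_conformal_algebra UNIV \<partial> circ brk"
    have poisson: "poisson_algebra M B"
      if "tilde_operation circ M" "tilde_operation brk B" for M B
      by (rule formal_dist_poisson_algebra.axioms(2)[OF formal_comm[OF that P]])
    show ?commutative
    proof (intro conjI allI impI)
      show "\<exists>!M. tilde_operation circ M" "\<exists>!B. tilde_operation brk B"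
        using ex1[OF poisson_conformal_algebra.axioms(1)[OF P]] by (rule conjunct1, rule conjunct2)
    qed (use poisson local iso con_comm[OF _ _ P] formal_comm[OF _ _ P] in \<open>elim conjE; blast\<close>)+
  qed
qed

end
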